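(* In the half-duplex dynamic-TDD cell-free model with zero-forcing precoding described in the context, for every $n\in\mathcal{U}_{\mathsf d}$ the downlink SINR of UE $n$ equals $$\eta_{\mathsf d,n}=\frac{(N-\tau_p)\,\mathcal{E}_{\mathsf d}\left(\sum_{j\in\mathcal{A}_{\mathsf d}}\alpha_{jn}\kappa_{jn}\right)^2}{\mathtt{EST}_{\mathsf d,n}+\mathtt{MUI}_{\mathsf d,n}+\mathtt{IUE}_n+N_0},$$ where $$\mathtt{EST}_{\mathsf d,n}=\sum_{q\in\mathcal{U}_{\mathsf d}}\sum_{j\in\mathcal{A}_{\mathsf d}}\mathcal{E}_{\mathsf d}\kappa_{jq}^2(\beta_{jn}-\alpha_{jn}^2),$$ $$\mathtt{MUI}_{\mathsf d,n}=(N-\tau_p)\mathcal{E}_{\mathsf d}\sum_{q\in(\mathcal{P}_{l(n)}\cap\mathcal{U}_{\mathsf d})\setminus\{n\}}\Big(\sum_{j\in\mathcal{A}_{\mathsf d}}\kappa_{jq}\alpha_{jn}\Big)^2,\qquad \mathtt{IUE}_n=\sum_{k\in\mathcal{U}_{\mathsf u}}\mathcal{E}_{\mathsf u,k}\epsilon_{nk}.$$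
   Context: **Sets and channels.** $\mathcal{A}_{\mathsf d}$ is a finite set of downlink access points (APs), each with $N$ antennas. $\mathcal{U}_{\mathsf u},\mathcal{U}_{\mathsf d}$ are disjoint finite sets of uplink and downlink users (UEs), and $\mathcal{U}=\mathcal{U}_{\mathsf u}\cup\mathcal{U}_{\mathsf d}$. The channel between UE $k\in\mathcal{U}$ and AP $j$ is $\mathbf{f}_{jk}\sim\mathcal{CN}(\mathbf{0},\beta_{jk}\mathbf{I}_N)$ with $\beta_{jk}>0$, independent over $(j,k)$. The channel from uplink UE $k$ to downlink UE $n$ is $\mathtt{g}_{nk}\sim\mathcal{CN}(0,\epsilon_{nk})$. All channels and noises are mutually independent. **Pilots.** UE $k$ uses pilot index $l(k)\in\{1,\dots,\tau_p\}$ (out of $\tau_p$ orthonormal pilots) with pilot power $\mathcal{E}_{p,k}>0$. $\mathcal{P}_{l(k)}$ is the set of all UEs using pilot $l(k)$. After despreading, AP $j$ has the matrix $\mathbf{Z}_j\in\mathbb{C}^{N\times\tau_p}$ whose $l$th column is $\sum_{k:\,l(k)=l}\sqrt{\tau_p\mathcal{E}_{p,k}}\,\mathbf{f}_{jk}+\mathbf{w}_{j,l}$, with $\mathbf{w}_{j,l}\sim\mathcal{CN}(\mathbf{0},N_0\mathbf{I}_N)$ independent and $N_0>0$. Let $c_{jk}=(\tau_p\sum_{q\in\mathcal{P}_{l(k)}}\mathcal{E}_{p,q}\beta_{jq}+N_0)^{-1}$ and $\alpha_{jk}=\sqrt{c_{jk}\tau_p\mathcal{E}_{p,k}}\,\beta_{jk}$.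 Thus the MMSE estimate of $\mathbf{f}_{jk}$ is $\mathcal{CN}(\mathbf{0},\alpha_{jk}^2\mathbf{I}_N)$. Assume $N\ge\tau_p+1$. **Zero-forcing precoder.** $\mathbf{p}_{jn}=\mathbf{Z}_j(\mathbf{Z}_j^H\mathbf{Z}_j)^{-1}\mathbf{e}_{l(n)}/\sqrt{\mathbb{E}\|\mathbf{Z}_j(\mathbf{Z}_j^H\mathbf{Z}_j)^{-1}\mathbf{e}_{l(n)}\|^2}$, with $\mathbf{e}_l$ the $l$th standard basis vector of $\mathbb{C}^{\tau_p}$. **Downlink SINR.** $\mathcal{E}_{\mathsf d}>0$ is the downlink AP power, $\mathcal{E}_{\mathsf u,k}\ge0$ are uplink powers, and $\kappa_{jn}\ge0$ are downlink power control coefficients, with $\boldsymbol{\kappa}_n=(\kappa_{jn})_{j\in\mathcal{A}_{\mathsf d}}$. With $[\mathbf{d}_{nq}]_j=\mathbf{f}_{jn}^H\mathbf{p}_{jq}$, the SINR is defined as $$\eta_{\mathsf d,n}=\frac{\mathcal{E}_{\mathsf d}|\boldsymbol{\kappa}_n^T\mathbb{E}[\mathbf{d}_{nn}]|^2}{\mathcal{E}_{\mathsf d}\,\mathrm{var}\{\boldsymbol{\kappa}_n^T\mathbf{d}_{nn}\}+\mathcal{E}_{\mathsf d}\sum_{q\in\mathcal{U}_{\mathsf d}\setminus\{n\}}\mathbb{E}[|\boldsymbol{\kappa}_q^T\mathbf{d}_{nq}|^2]+\sum_{k\in\mathcal{U}_{\mathsf u}}\mathcal{E}_{\mathsf u,k}\mathbb{E}|\mathtt{g}_{nk}|^2+N_0}.$$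 *)

theory Defs
  imports "HOL-Probability.Probability"
begin

(* The law CN(0, v I). On the real Euclidean space underlying complex^'n (dimension 2 * CARD('n)),
   CN(0, I) has density exp (- norm x ^ 2) / pi ^ CARD('n); on complex itself this is the scalar
   case. Scaling by sqrt v gives CN(0, v I) and turns v = 0 into the point mass at 0. *)

definition CN :: "real \<Rightarrow> 'a::euclidean_space measure" where
  "CN v = distr (density lborel (\<lambda>x. ennreal (exp (- (norm x)\<^sup>2) / sqrt pi ^ DIM('a)))) borel
            (\<lambda>x. sqrt v *\<^sub>R x)"

definition has_CN :: "'w measure \<Rightarrow> ('w \<Rightarrow> 'a::euclidean_space) \<Rightarrow> real \<Rightarrow> bool" where
  "has_CN M X v \<longleftrightarrow> X \<in> borel_measurable M \<and> distr M borel X = CN v"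

(* Index of the elementary random quantities. They take values in different types, so their mutual
   independence is stated for the sigma-algebras they generate, as in the definition of
   indep_vars. *)

datatype ('a, 'u, 't) source = AP_UE 'a 'u | Pilot_Noise 'a 't | UE_UE 'u 'u

definition generated_events :: "'w measure \<Rightarrow> ('w \<Rightarrow> 'b::topological_space) \<Rightarrow> 'w set set" where
  "generated_events M X = {X -` B \<inter> space M | B. B \<in> sets borel}"

definition source_events ::
  "'w measure \<Rightarrow> ('a \<Rightarrow> 'u \<Rightarrow> 'w \<Rightarrow> complex^'n) \<Rightarrow> ('a \<Rightarrow> 't \<Rightarrow> 'w \<Rightarrow> complex^'n) \<Rightarrow>
   ('u \<Rightarrow> 'u \<Rightarrow> 'w \<Rightarrow> complex) \<Rightarrow> ('a, 'u, 't) source \<Rightarrow> 'w set set" where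
  "source_events M f w g s =
     (case s of
        AP_UE j k \<Rightarrow> generated_events M (f j k)
      | Pilot_Noise j i \<Rightarrow> generated_events M (w j i)
      | UE_UE n k \<Rightarrow> generated_events M (g n k))"

definition sources :: "'a set \<Rightarrow> 'u set \<Rightarrow> 'u set \<Rightarrow> ('a, 'u, 't) source set" where
  "sources Ad Uu Ud =
     {AP_UE j k | j k. j \<in> Ad \<and> k \<in> Uu \<union> Ud} \<union> {Pilot_Noise j i | j i. j \<in> Ad} \<union>
     {UE_UE n k | n k. n \<in> Ud \<and> k \<in> Uu}"

definition cinner :: "complex^'n \<Rightarrow> complex^'n \<Rightarrow> complex" where
  "cinner x y = (\<Sum>i\<in>UNIV. cnj (x $ i) * y $ i)"

definition ctranspose :: "complex^'m^'n \<Rightarrow> complex^'n^'m" where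
  "ctranspose A = (\<chi> i j. cnj (A $ j $ i))"

definition cvariance :: "'w measure \<Rightarrow> ('w \<Rightarrow> complex) \<Rightarrow> real" where
  "cvariance M X = (\<integral>\<omega>. (cmod (X \<omega> - (\<integral>\<omega>'. X \<omega>' \<partial>M)))\<^sup>2 \<partial>M)"

(* Pilots are indexed by the finite type 't, so tau_p = CARD('t); l k is the pilot of UE k,
   U the set of all UEs, and Ep the pilot powers. *)

definition pilot_group :: "'u set \<Rightarrow> ('u \<Rightarrow> 't) \<Rightarrow> 't \<Rightarrow> 'u set" where
  "pilot_group U l i = {k \<in> U. l k = i}"

definition despread_matrix ::
  "'u set \<Rightarrow> ('u \<Rightarrow> 't::finite) \<Rightarrow> ('u \<Rightarrow> real) \<Rightarrow> ('a \<Rightarrow> 'u \<Rightarrow> 'w \<Rightarrow> complex^'n) \<Rightarrow>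
   ('a \<Rightarrow> 't \<Rightarrow> 'w \<Rightarrow> complex^'n) \<Rightarrow> 'a \<Rightarrow> 'w \<Rightarrow> complex^'t^'n" where
  "despread_matrix U l Ep f w j \<omega> =
     (\<chi> r i. ((\<Sum>k\<in>pilot_group U l i. sqrt (real CARD('t) * Ep k) *\<^sub>R f j k \<omega>) + w j i \<omega>) $ r)"

definition c_coeff ::
  "'u set \<Rightarrow> ('u \<Rightarrow> 't::finite) \<Rightarrow> ('u \<Rightarrow> real) \<Rightarrow> ('a \<Rightarrow> 'u \<Rightarrow> real) \<Rightarrow> real \<Rightarrow> 'a \<Rightarrow> 'u \<Rightarrow> real" where
  "c_coeff U l Ep \<beta> N0 j k =
     inverse (real CARD('t) * (\<Sum>q\<in>pilot_group U l (l k). Ep q * \<beta> j q) + N0)"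

definition alpha_coeff ::
  "'u set \<Rightarrow> ('u \<Rightarrow> 't::finite) \<Rightarrow> ('u \<Rightarrow> real) \<Rightarrow> ('a \<Rightarrow> 'u \<Rightarrow> real) \<Rightarrow> real \<Rightarrow> 'a \<Rightarrow> 'u \<Rightarrow> real" where
  "alpha_coeff U l Ep \<beta> N0 j k =
     sqrt (c_coeff U l Ep \<beta> N0 j k * real CARD('t) * Ep k) * \<beta> j k"

(* matrix_inv has a fixed arbitrary value on singular matrices. *)

definition zf_direction :: "complex^'t^'n \<Rightarrow> 't \<Rightarrow> complex^'n" where
  "zf_direction Z i = (Z ** matrix_inv (ctranspose Z ** Z)) *v axis i 1"

definition zf_precoder :: "'w measure \<Rightarrow> ('w \<Rightarrow> complex^'t^'n) \<Rightarrow> 't \<Rightarrow> 'w \<Rightarrow> complex^'n" where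
  "zf_precoder M Z i \<omega> =
     zf_direction (Z \<omega>) i /\<^sub>R sqrt (\<integral>\<omega>'. (norm (zf_direction (Z \<omega>') i))\<^sup>2 \<partial>M)"

(* eff_channel f p n q \<omega> j is the j-th entry of d_nq, and precode Ad \<kappa> q x is kappa_q^T x. *)

definition eff_channel ::
  "('a \<Rightarrow> 'u \<Rightarrow> 'w \<Rightarrow> complex^'n) \<Rightarrow> ('a \<Rightarrow> 'u \<Rightarrow> 'w \<Rightarrow> complex^'n) \<Rightarrow> 'u \<Rightarrow> 'u \<Rightarrow> 'w \<Rightarrow> 'a \<Rightarrow> complex" where
  "eff_channel f p n q \<omega> j = cinner (f j n \<omega>) (p j q \<omega>)"

definition precode :: "'a set \<Rightarrow> ('a \<Rightarrow> 'u \<Rightarrow> real) \<Rightarrow> 'u \<Rightarrow> ('a \<Rightarrow> complex) \<Rightarrow> complex" where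
  "precode Ad \<kappa> q x = (\<Sum>j\<in>Ad. complex_of_real (\<kappa> j q) * x j)"

definition downlink_sinr ::
  "'w measure \<Rightarrow> 'a set \<Rightarrow> 'u set \<Rightarrow> 'u set \<Rightarrow> real \<Rightarrow> ('u \<Rightarrow> real) \<Rightarrow> real \<Rightarrow> ('a \<Rightarrow> 'u \<Rightarrow> real) \<Rightarrow>
   ('a \<Rightarrow> 'u \<Rightarrow> 'w \<Rightarrow> complex^'n) \<Rightarrow> ('u \<Rightarrow> 'u \<Rightarrow> 'w \<Rightarrow> complex) \<Rightarrow>
   ('a \<Rightarrow> 'u \<Rightarrow> 'w \<Rightarrow> complex^'n) \<Rightarrow> 'u \<Rightarrow> real" where
  "downlink_sinr M Ad Uu Ud Ed Eu N0 \<kappa> f g p n =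
     Ed * (cmod (precode Ad \<kappa> n (\<lambda>j. \<integral>\<omega>. eff_channel f p n n \<omega> j \<partial>M)))\<^sup>2 /
     (Ed * cvariance M (\<lambda>\<omega>. precode Ad \<kappa> n (eff_channel f p n n \<omega>))
      + Ed * (\<Sum>q\<in>Ud - {n}. \<integral>\<omega>. (cmod (precode Ad \<kappa> q (eff_channel f p n q \<omega>)))\<^sup>2 \<partial>M)
      + (\<Sum>k\<in>Uu. Eu k * (\<integral>\<omega>. (cmod (g n k \<omega>))\<^sup>2 \<partial>M))
      + N0)"

end

theory Submission
  imports Defs "HOL-Real_Asymp.Real_Asymp"
begin

text \<open>
  At a fixed AP the columns of \<open>Z\<close> are independent Gaussian vectors, and linear regression splits
  the channel of a user as \<open>f = a z + r\<close>, where \<open>z\<close> is the column of its pilot and \<open>r\<close> is a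
  Gaussian vector independent of \<open>Z\<close>. Zero forcing makes \<open>z\<^sup>H p\<close> deterministic, so
  \<open>f\<^sup>H p\<close> is a constant plus the centred variable \<open>r\<^sup>H p\<close> of variance
  \<open>\<beta> - \<alpha>\<^sup>2\<close>, and these variables are uncorrelated over the APs. The
  normalisation \<open>E \<parallel>Z (Z\<^sup>H Z)\<^sup>-\<^sup>1 e\<^sub>l\<parallel>\<^sup>2\<close> is the mean of \<open>1 / \<parallel>P z\<parallel>\<^sup>2\<close>, where \<open>P\<close>
  projects orthogonally to the other columns, onto a space of complex dimension
  \<open>m = N - \<tau> + 1\<close>. Writing \<open>1 / q\<close> as the integral of \<open>exp (- t q)\<close> over \<open>t \<ge> 0\<close>
  turns it into the integral of \<open>(1 + t v)\<^sup>-\<^sup>m\<close>, that is \<open>1 / (v (N - \<tau>))\<close>, where \<open>v\<close> is the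
  variance of the column.
\<close>

section \<open>Circularly symmetric Gaussian measures\<close>

text \<open>Zero forcing is nonlinear in all of \<open>Z\<close>, so covariances do not determine
  its moments and true independence is needed. Between \<open>r\<close> and \<open>z\<close> it
  comes from rotation invariance: two independent standard Gaussian vectors form one standard
  Gaussian vector on the product space, and passing to \<open>(r, z)\<close> is a rotation of it up
  to scaling. Between \<open>r\<close> and the other columns it comes from disjoint sets of channels
  and noises. Full rank of \<open>Z\<close> holds only almost surely: given the others, a column
  avoids their span.

  The integral of \<open>(1 + t v)\<^sup>-\<^sup>m\<close> converges for m at least 2, which is the
  assumption on the number of antennas. As \<open>v\<close> is the inverse of \<open>c\<close>, the
  product \<open>a sqrt v\<close> is \<alpha>; the constant part of \<open>f\<^sup>H p\<close> is
  therefore \<open>sqrt (N - \<tau>) \<alpha>\<close> when \<open>p\<close> belongs to the pilot of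
  \<open>f\<close>, and 0 otherwise. Constants add coherently over the APs, which gives the squared
  sums, whereas residuals add in power for every precoder, because each has mean power 1; hence EST
  runs over all downlink users.\<close>

lemma nn_integral_lborel_translate:
  fixes f :: "'a::euclidean_space \<Rightarrow> ennreal"
  assumes [measurable]: "f \<in> borel_measurable borel"
  shows "(\<integral>\<^sup>+x. f (x + c) \<partial>lborel) = (\<integral>\<^sup>+x. f x \<partial>lborel)"
proof -
  have "(\<integral>\<^sup>+x. f x \<partial>lborel) = (\<integral>\<^sup>+x. f x \<partial>distr lborel borel ((+) c))"
    by (simp add: lborel_distr_plus)
  then show ?thesis by (simp add: nn_integral_distr add.commute)
qed

lemma borel_measurable_linear:
  fixes T :: "'a::euclidean_space \<Rightarrow> 'b::euclidean_space"
  assumes "linear T" shows "T \<in> borel_measurable borel"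
  using assms by (intro borel_measurable_continuous_onI linear_continuous_on) (simp add: linear_conv_bounded_linear)

text \<open>As for the uniqueness of Haar measure: the image measure is translation invariant, hence a
  multiple of the Lebesgue measure by Fubini, and the unit ball shows that the factor is 1.\<close>

lemma lborel_orthogonal_invariant:
  fixes T :: "'a::euclidean_space \<Rightarrow> 'a"
  assumes T: "orthogonal_transformation T"
  shows "distr lborel borel T = lborel"
proof -
  have lin: "linear T" using T by (simp add: orthogonal_transformation)
  have nT: "norm (T x) = norm x" for x using T by (simp add: orthogonal_transformation)
  have [measurable]: "T \<in> borel_measurable borel" by (rule borel_measurable_linear[OF lin])
  have "inj T" using lin nT by (metis linear_injective_0 norm_eq_zero)
  then have "surj T" using lin linear_injective_imp_surjective by blast
  have *: "(\<integral>\<^sup>+x. f (T x) \<partial>lborel) = (\<integral>\<^sup>+x. f x \<partial>lborel)"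
    if [measurable]: "f \<in> borel_measurable borel" for f
  proof -
    \<comment> \<open>The ball is chosen because \<open>T\<close> and negation preserve it:
      \<open>g (- T x) = g x\<close> removes \<open>T\<close> from the second factor. Its mass is
      positive and finite, so it cancels in the end.\<close>
    define g where "g = (indicator (ball (0::'a) 1) :: 'a \<Rightarrow> ennreal)"
    have [measurable]: "g \<in> borel_measurable borel" unfolding g_def by (rule borel_measurable_indicator) simp
    have gneg: "g (- T x) = g x" for x by (simp add: g_def indicator_def nT)
    have int_g: "integral\<^sup>N lborel g = emeasure lborel (ball (0::'a) 1)"
      by (simp add: g_def)
    have "(\<integral>\<^sup>+x. f (T x) \<partial>lborel) * integral\<^sup>N lborel g = (\<integral>\<^sup>+x. f (T x) * (\<integral>\<^sup>+y. g y \<partial>lborel) \<partial>lborel)"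
      by (simp add: nn_integral_multc)
    also have "\<dots> = (\<integral>\<^sup>+x. \<integral>\<^sup>+y. f (T x) * g (y + - T x) \<partial>lborel \<partial>lborel)"
      by (intro nn_integral_cong, subst nn_integral_cmult) (simp_all only: nn_integral_lborel_translate[of g] \<open>g \<in> _\<close>, auto)
    also have "\<dots> = (\<integral>\<^sup>+y. \<integral>\<^sup>+x. f (T x) * g (y + - T x) \<partial>lborel \<partial>lborel)"
      by (rule lborel_pair.Fubini') measurable
    also have "\<dots> = (\<integral>\<^sup>+y. \<integral>\<^sup>+x. f (T x + y) * g x \<partial>lborel \<partial>lborel)"
    proof (rule nn_integral_cong)
      fix y :: 'a
      \<comment> \<open>Shifting \<open>x\<close> by a preimage of \<open>y\<close> uses
        surjectivity: \<open>T (x + c) = T x + y\<close>, so \<open>y\<close> leaves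
        \<open>g\<close> and enters \<open>f\<close>.\<close>
      obtain c where c: "T c = y" using \<open>surj T\<close> by (metis surjD)
      have "(\<integral>\<^sup>+x. f (T x) * g (y + - T x) \<partial>lborel) = (\<integral>\<^sup>+x. f (T (x + c)) * g (y + - T (x + c)) \<partial>lborel)"
        by (rule nn_integral_lborel_translate[symmetric]) measurable
      also have "\<dots> = (\<integral>\<^sup>+x. f (T x + y) * g x \<partial>lborel)"
        using gneg by (simp add: linear_add[OF lin] c)
      finally show "(\<integral>\<^sup>+x. f (T x) * g (y + - T x) \<partial>lborel) = (\<integral>\<^sup>+x. f (T x + y) * g x \<partial>lborel)" .
    qed
    also have "\<dots> = (\<integral>\<^sup>+x. \<integral>\<^sup>+y. f (y + T x) * g x \<partial>lborel \<partial>lborel)"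
      by (subst lborel_pair.Fubini') (auto simp: add.commute)
    also have "\<dots> = (\<integral>\<^sup>+y. f y \<partial>lborel) * integral\<^sup>N lborel g"
      by (simp add: nn_integral_multc nn_integral_lborel_translate[of f] nn_integral_cmult)
    finally have eq: "(\<integral>\<^sup>+x. f (T x) \<partial>lborel) * integral\<^sup>N lborel g = (\<integral>\<^sup>+x. f x \<partial>lborel) * integral\<^sup>N lborel g" .
    have "0 < emeasure lborel (ball (0::'a) 1)" "emeasure lborel (ball (0::'a) 1) < \<infinity>"
      by (auto simp: emeasure_ball unit_ball_vol_pos intro!: emeasure_lborel_ball_finite)
    then show ?thesis using eq unfolding int_g
      by (subst (asm) (1 2) mult.commute) (auto simp: ennreal_mult_cancel_left)
  qed
  show ?thesis
  proof (rule measure_eqI)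
    fix A assume "A \<in> sets (distr lborel borel T)"
    then have [measurable]: "A \<in> sets borel" by simp
    show "emeasure (distr lborel borel T) A = emeasure lborel A"
      using *[of "indicator A"]
      by (simp flip: nn_integral_indicator add: nn_integral_distr)
  qed simp
qed

section \<open>Product form, rotation invariance and pairs of Gaussian measures\<close>

lemma sets_CN [simp, measurable_cong]: "sets (CN v) = sets borel"
  and space_CN [simp]: "space (CN v) = UNIV"
  by (simp_all add: CN_def)

lemma CN_1: "CN 1 = density lborel (\<lambda>x::'a::euclidean_space. ennreal (exp (- (norm x)\<^sup>2) / sqrt pi ^ DIM('a)))"
  unfolding CN_def real_sqrt_one scaleR_one by (rule distr_id2) simp

lemma CN_scale: "CN v = distr (CN 1) borel (\<lambda>x. sqrt v *\<^sub>R x)"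
  unfolding CN_1 by (simp add: CN_def)

lemma nn_integral_CN:
  fixes h :: "'a::euclidean_space \<Rightarrow> ennreal"
  assumes [measurable]: "h \<in> borel_measurable borel"
  shows "integral\<^sup>N (CN v) h = integral\<^sup>N (CN 1) (\<lambda>x. h (sqrt v *\<^sub>R x))"
  by (subst CN_scale) (simp add: nn_integral_distr)

text \<open>The squared norm is the sum of the squared real coordinates. Each factor is the density
  of the real normal law of variance 1/2, so that the two real coordinates of a complex entry add up
  to variance 1.\<close>

lemma exp_norm_eq_prod:
  "exp (- (norm (x::'a::euclidean_space))\<^sup>2) / sqrt pi ^ DIM('a) = (\<Prod>b\<in>Basis. exp (- (x \<bullet> b)\<^sup>2) / sqrt pi)"
  by (simp add: prod_dividef norm_eq_sqrt_inner euclidean_inner[of x x] exp_sum sum_nonneg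
      flip: sum_negf power2_eq_square)

text \<open>The real coordinates are independent, so Tonelli splits the integral. Later Gaussian
  integrals are brought to this form by a rotation.\<close>

lemma nn_integral_CN_1_prod:
  fixes h :: "'a::euclidean_space \<Rightarrow> real \<Rightarrow> real"
  assumes [measurable]: "\<And>b. b \<in> Basis \<Longrightarrow> h b \<in> borel_measurable borel"
    and nn: "\<And>b x. b \<in> Basis \<Longrightarrow> 0 \<le> h b x"
  shows "(\<integral>\<^sup>+x. (\<Prod>b\<in>Basis. h b (x \<bullet> b)) \<partial>CN 1) =
         (\<Prod>b\<in>Basis. \<integral>\<^sup>+x. h b x * (exp (- x\<^sup>2) / sqrt pi) \<partial>lborel)"
proof -
  have "(\<integral>\<^sup>+x. (\<Prod>b\<in>Basis. h b (x \<bullet> b)) \<partial>CN 1) =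
    (\<integral>\<^sup>+x. (\<Prod>b\<in>Basis. ennreal (h b (x \<bullet> b) * (exp (- (x \<bullet> b)\<^sup>2) / sqrt pi))) \<partial>lborel)"
    unfolding CN_1 by (subst nn_integral_density)
      (auto simp: exp_norm_eq_prod prod_ennreal nn prod_nonneg mult.commute simp flip: ennreal_mult prod.distrib
       intro!: nn_integral_cong)
  also have "\<dots> = (\<Prod>b\<in>Basis. \<integral>\<^sup>+x. h b x * (exp (- x\<^sup>2) / sqrt pi) \<partial>lborel)"
    by (subst nn_integral_lborel_prod) auto
  finally show ?thesis .
qed

lemma nn_integral_exp_square:
  assumes "0 < a"
  shows "(\<integral>\<^sup>+x. ennreal (exp (- a * x\<^sup>2) / sqrt pi) \<partial>lborel) = ennreal (1 / sqrt a)"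
proof -
  have "(\<integral>\<^sup>+x. ennreal (exp (- a * x\<^sup>2) / sqrt pi) \<partial>lborel) =
        (\<integral>\<^sup>+x. ennreal (1 / sqrt a) * ennreal (normal_density 0 (1 / sqrt (2 * a)) x) \<partial>lborel)"
    using assms
    by (intro nn_integral_cong)
       (simp add: normal_density_def power_divide real_sqrt_mult real_sqrt_divide field_simps flip: ennreal_mult')
  also have "\<dots> = ennreal (1 / sqrt a)"
    using assms by (subst nn_integral_cmult)
      (auto simp: nn_integral_eq_integral integrable_normal_density integral_normal_density)
  finally show ?thesis .
qed

lemma nn_integral_square_exp_square:
  "(\<integral>\<^sup>+x. ennreal (x\<^sup>2 * (exp (- x\<^sup>2) / sqrt pi)) \<partial>lborel) = ennreal (1 / 2)"
proof -
  have "normal_density 0 (1 / sqrt 2) x * (x - 0) ^ (2 * 1) = x\<^sup>2 * (exp (- x\<^sup>2) / sqrt pi)" for x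
    by (simp add: normal_density_def power_divide)
  then have "has_bochner_integral lborel (\<lambda>x. x\<^sup>2 * (exp (- x\<^sup>2) / sqrt pi)) (1 / 2)"
    using normal_moment_even[of "1 / sqrt 2" 0 1] by (simp add: power_divide)
  then show ?thesis
    by (subst nn_integral_eq_integral) (auto simp: has_bochner_integral_iff)
qed

lemma prob_space_CN: "prob_space (CN v :: 'a::euclidean_space measure)"
proof -
  have "emeasure (CN 1 :: 'a measure) UNIV = 1"
    using nn_integral_CN_1_prod[of "\<lambda>(_::'a) _. 1"] nn_integral_exp_square[of 1]
    by simp
  then have "prob_space (CN 1 :: 'a measure)" by (intro prob_spaceI) simp
  then show ?thesis unfolding CN_scale[of v] by (rule prob_space.prob_space_distr) simp
qed

text \<open>The density depends on the norm alone, Lebesgue measure is invariant, and scaling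
  commutes with the linear map \<open>T\<close>.\<close>

lemma distr_CN_orthogonal:
  fixes T :: "'a::euclidean_space \<Rightarrow> 'a"
  assumes T: "orthogonal_transformation T"
  shows "distr (CN v) borel T = CN v"
proof -
  have lin: "linear T" using T by (simp add: orthogonal_transformation)
  have [measurable]: "T \<in> borel_measurable borel" by (rule borel_measurable_linear[OF lin])
  have n: "norm (T x) = norm x" for x using T by (simp add: orthogonal_transformation)
  define h where "h = (\<lambda>x::'a. ennreal (exp (- (norm x)\<^sup>2) / sqrt pi ^ DIM('a)))"
  have [measurable]: "h \<in> borel_measurable borel" by (simp add: h_def)
  have "CN 1 = density (distr lborel borel T) h"
    by (simp add: CN_1 h_def lborel_orthogonal_invariant[OF T])
  also have "\<dots> = distr (density lborel (\<lambda>x. h (T x))) borel T"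
    by (rule density_distr) auto
  also have "density lborel (\<lambda>x. h (T x)) = CN 1" by (simp add: CN_1 h_def n)
  finally have 1: "distr (CN 1) borel T = CN 1" ..
  have "distr (CN v) borel T = distr (CN 1) borel (\<lambda>x. T (sqrt v *\<^sub>R x))"
    by (subst CN_scale) (simp add: distr_distr o_def)
  also have "\<dots> = distr (distr (CN 1) borel T) borel (\<lambda>x. sqrt v *\<^sub>R x)"
    by (simp add: distr_distr o_def linear_cmul[OF lin])
  finally show ?thesis by (simp add: 1 CN_scale[of v])
qed

text \<open>Squared norms add up on a product space, so the densities multiply. Two independent
  standard vectors thus become one Gaussian vector, to which rotations of the product apply.\<close>

lemma CN_1_pair: "(CN 1 :: 'a::euclidean_space measure) \<Otimes>\<^sub>M (CN 1 :: 'b::euclidean_space measure) = CN 1"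
proof -
  interpret prob_space "CN 1 :: 'b measure" by (rule prob_space_CN)
  have [measurable]: "(\<lambda>x::'a \<times> 'b. norm x) \<in> borel_measurable (borel \<Otimes>\<^sub>M borel)"
    unfolding borel_prod by measurable
  have "(CN 1 :: 'a measure) \<Otimes>\<^sub>M (CN 1 :: 'b measure) = density (lborel \<Otimes>\<^sub>M lborel)
      (\<lambda>(x, y). ennreal (exp (- (norm x)\<^sup>2) / sqrt pi ^ DIM('a)) * ennreal (exp (- (norm y)\<^sup>2) / sqrt pi ^ DIM('b)))"
    using sigma_finite_measure_axioms unfolding CN_1
    by (intro pair_measure_density) (auto simp: sigma_finite_lborel)
  also have "\<dots> = CN 1"
    unfolding CN_1 lborel_prod
    by (intro density_cong)
      (auto simp: norm_Pair exp_add[symmetric] power_add field_simps borel_prod[symmetric] split_beta' simp flip: ennreal_mult intro!: AE_I2)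
  finally show ?thesis .
qed

text \<open>Complete \<open>S\<close> to an orthonormal basis and let \<open>T\<close> map
  \<open>Basis\<close> onto it. By rotation invariance a functional of the Gaussian coordinates
  along \<open>S\<close> then has the law of the same functional of standard coordinates.\<close>

lemma orthonormal_to_Basis:
  fixes S :: "'a::euclidean_space set"
  assumes orth: "pairwise orthogonal S" and unit: "\<And>x. x \<in> S \<Longrightarrow> norm x = 1"
  obtains T :: "'a \<Rightarrow> 'a" and B k where "orthogonal_transformation T" "B \<subseteq> Basis" "bij_betw k B S"
    "\<And>b y. b \<in> B \<Longrightarrow> T y \<bullet> k b = y \<bullet> b"
proof -
  \<comment> \<open>The completion is an orthonormal basis of the orthogonal complement of
    \<open>span S\<close>; the dimension count below makes \<open>S \<union> C\<close> as large as
    \<open>Basis\<close>.\<close>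
  define W where "W = {y \<in> UNIV. \<forall>x \<in> span S. orthogonal x y}"
  have "subspace W"
    unfolding W_def using subspace_orthogonal_to_vectors[of "span S"] by (simp add: orthogonal_commute)
  then obtain C where C: "C \<subseteq> W" "pairwise orthogonal C" "\<And>x. x \<in> C \<Longrightarrow> norm x = 1"
      "independent C" "card C = dim W"
    using orthonormal_basis_subspace by metis
  have "0 \<notin> S" using unit by force
  then have indS: "independent S" using orth by (intro pairwise_orthogonal_independent)
  have fin: "finite S" "finite C"
    using indS C(4) by (auto intro: independent_imp_finite)
  have SC: "orthogonal x y" if "x \<in> S" "y \<in> C" for x y
    using that C(1) by (auto simp: W_def intro: span_base)
  have disj: "S \<inter> C = {}"
  proof -
    have False if "x \<in> S" "x \<in> C" for x
      using SC[OF that] unit[OF that(1)] by (simp add: orthogonal_def norm_eq_1)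
    then show ?thesis by blast
  qed
  have orthSC: "x \<bullet> y = (if x = y then 1 else 0)" if "x \<in> S \<union> C" "y \<in> S \<union> C" for x y
    using that orth unit C(2,3) SC
    by (auto simp: pairwise_def orthogonal_def norm_eq_1) (metis inner_commute)
  have "dim W + dim (span S) = dim (UNIV :: 'a set)"
    unfolding W_def by (rule dim_subspace_orthogonal_to_vectors) auto
  then have "card (S \<union> C) = card (Basis :: 'a set)"
    using fin disj C(5) dim_eq_card_independent[OF indS] by (simp add: card_Un_disjoint)
  then obtain k where k: "bij_betw k (Basis :: 'a set) (S \<union> C)"
    using fin by (metis finite_Basis finite_UnI finite_same_card_bij)
  define T where "T = (\<lambda>y. \<Sum>b\<in>Basis. (y \<bullet> b) *\<^sub>R k b)"
  have kk: "k b \<bullet> k b' = (if b = b' then 1 else 0)" if "b \<in> Basis" "b' \<in> Basis" for b b'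
  proof -
    have "k b \<in> S \<union> C" "k b' \<in> S \<union> C" using that k by (auto simp: bij_betw_def)
    moreover have "k b = k b' \<longleftrightarrow> b = b'" using that k by (auto simp: bij_betw_def inj_on_def)
    ultimately show ?thesis using orthSC by simp
  qed
  have Tk: "T y \<bullet> k b = y \<bullet> b" if "b \<in> Basis" for y b
  proof -
    have "T y \<bullet> k b = (\<Sum>b'\<in>Basis. (y \<bullet> b') * (k b' \<bullet> k b))"
      by (simp add: T_def inner_sum_left)
    also have "\<dots> = (\<Sum>b'\<in>Basis. if b' = b then y \<bullet> b' else 0)"
      using that by (intro sum.cong) (auto simp: kk)
    finally show ?thesis using that by simp
  qed
  show thesis
  proof
    show "orthogonal_transformation T"
    proof (unfold orthogonal_transformation_def, intro conjI allI)
      show "linear T"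
        by (auto simp: T_def linear_iff inner_add_left scaleR_add_left sum.distrib scaleR_sum_right)
      show "T v \<bullet> T w = v \<bullet> w" for v w
      proof -
        have "T v \<bullet> T w = (\<Sum>b\<in>Basis. (w \<bullet> b) * (T v \<bullet> k b))"
          by (simp add: T_def[of] inner_sum_right)
        also have "\<dots> = v \<bullet> w" by (simp add: Tk euclidean_inner[of v w] mult.commute)
        finally show ?thesis .
      qed
    qed
    show "{b \<in> Basis. k b \<in> S} \<subseteq> Basis" by blast
    show "bij_betw k {b \<in> Basis. k b \<in> S} S"
      using k unfolding bij_betw_def inj_on_def by blast
    show "T y \<bullet> k b = y \<bullet> b" if "b \<in> {b \<in> Basis. k b \<in> S}" for b y using Tk that by blast
  qed
qed

section \<open>Laplace transforms, second moments and inverse moments\<close>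

lemma nn_integral_CN_orthogonal:
  fixes T :: "'a::euclidean_space \<Rightarrow> 'a"
  assumes T: "orthogonal_transformation T" and [measurable]: "h \<in> borel_measurable borel"
  shows "(\<integral>\<^sup>+x. h (T x) \<partial>CN v) = (\<integral>\<^sup>+x. h x \<partial>CN v)"
proof -
  have [measurable]: "T \<in> borel_measurable borel"
    using T by (intro borel_measurable_linear) (simp add: orthogonal_transformation)
  have "(\<integral>\<^sup>+x. h x \<partial>CN v) = (\<integral>\<^sup>+x. h x \<partial>distr (CN v) borel T)"
    by (simp add: distr_CN_orthogonal[OF T])
  then show ?thesis by (simp add: nn_integral_distr)
qed

text \<open>This is the Laplace transform of the squared length of an orthogonal projection: after
  rotating \<open>S\<close> into \<open>Basis\<close>, each of its real coordinates contributes
  \<open>1 / sqrt (1 + t * v)\<close> and every other coordinate contributes 1.\<close>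

lemma nn_integral_CN_exp_orthonormal:
  fixes S :: "'a::euclidean_space set"
  assumes orth: "pairwise orthogonal S" and unit: "\<And>x. x \<in> S \<Longrightarrow> norm x = 1"
    and v: "0 \<le> v" and t: "0 \<le> t"
  shows "(\<integral>\<^sup>+x. exp (- t * (\<Sum>s\<in>S. (x \<bullet> s)\<^sup>2)) \<partial>CN v) = ennreal (1 / sqrt (1 + t * v) ^ card S)"
proof -
  obtain T :: "'a \<Rightarrow> 'a" and B k where T: "orthogonal_transformation T" and B: "B \<subseteq> Basis"
    and k: "bij_betw k B S" and Tk: "\<And>b y. b \<in> B \<Longrightarrow> T y \<bullet> k b = y \<bullet> b"
    by (rule orthonormal_to_Basis[OF orth unit]) (assumption, rule that)
  have finB: "finite B" by (rule finite_subset[OF B finite_Basis])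
  have vt: "0 \<le> t * v" using v t by simp
  have "(\<integral>\<^sup>+x. exp (- t * (\<Sum>s\<in>S. (x \<bullet> s)\<^sup>2)) \<partial>CN v) =
        (\<integral>\<^sup>+x. exp (- (t * v) * (\<Sum>s\<in>S. (x \<bullet> s)\<^sup>2)) \<partial>CN 1)"
  proof -
    have "(\<Sum>s\<in>S. (sqrt v *\<^sub>R x \<bullet> s)\<^sup>2) = v * (\<Sum>s\<in>S. (x \<bullet> s)\<^sup>2)" for x
      using v by (simp add: power_mult_distrib sum_distrib_left)
    then show ?thesis by (subst nn_integral_CN) (simp_all add: mult.assoc)
  qed
  also have "\<dots> = (\<integral>\<^sup>+x. exp (- (t * v) * (\<Sum>s\<in>S. (T x \<bullet> s)\<^sup>2)) \<partial>CN 1)"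
    by (rule nn_integral_CN_orthogonal[OF T, symmetric]) measurable
  also have "\<dots> = (\<integral>\<^sup>+x. exp (- (t * v) * (\<Sum>b\<in>B. (x \<bullet> b)\<^sup>2)) \<partial>CN 1)"
    by (subst sum.reindex_bij_betw[OF k, symmetric]) (simp add: Tk)
  also have "\<dots> = (\<integral>\<^sup>+x. (\<Prod>b\<in>Basis. if b \<in> B then exp (- (t * v) * (x \<bullet> b)\<^sup>2) else 1) \<partial>CN 1)"
    using B finB by (simp add: prod.If_cases Int_absorb1 exp_sum sum_distrib_left sum_negf[symmetric])
  also have "\<dots> = (\<Prod>b\<in>(Basis::'a set). \<integral>\<^sup>+x. (if b \<in> B then exp (- (t * v) * x\<^sup>2) else 1) * (exp (- x\<^sup>2) / sqrt pi) \<partial>lborel)"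
    by (rule nn_integral_CN_1_prod[of "\<lambda>b y. if b \<in> B then exp (- (t * v) * y\<^sup>2) else 1"]) auto
  also have "\<dots> = (\<Prod>b\<in>(Basis::'a set). if b \<in> B then ennreal (1 / sqrt (1 + t * v)) else 1)"
  proof (rule prod.cong)
    fix b :: 'a
    have *: "exp (- (t * v) * x\<^sup>2) * (exp (- x\<^sup>2) / sqrt pi) = exp (- (1 + t * v) * x\<^sup>2) / sqrt pi" for x
      by (simp add: exp_add[symmetric] algebra_simps)
    show "(\<integral>\<^sup>+x. (if b \<in> B then exp (- (t * v) * x\<^sup>2) else 1) * (exp (- x\<^sup>2) / sqrt pi) \<partial>lborel) =
        (if b \<in> B then ennreal (1 / sqrt (1 + t * v)) else 1)"
    proof (cases "b \<in> B")
      case True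
      show ?thesis using nn_integral_exp_square[of "1 + t * v"] vt by (simp only: True if_True *)
    next
      case False
      then show ?thesis using nn_integral_exp_square[of 1] by simp
    qed
  qed simp
  also have "\<dots> = ennreal (1 / sqrt (1 + t * v)) ^ card B"
    using B finB by (simp add: prod.If_cases Int_absorb1)
  also have "\<dots> = ennreal (1 / sqrt (1 + t * v) ^ card S)"
    using vt bij_betw_same_card[OF k] by (simp add: ennreal_power power_one_over)
  finally show ?thesis .
qed

text \<open>Each real coordinate of \<open>CN v\<close> has variance \<open>v / 2\<close>; a
  rotation exchanges the direction of \<open>u\<close> for a basis vector.\<close>

lemma nn_integral_CN_inner_square:
  fixes u :: "'a::euclidean_space"
  assumes v: "0 \<le> v"
  shows "(\<integral>\<^sup>+x. (x \<bullet> u)\<^sup>2 \<partial>CN v) = ennreal (v / 2 * (norm u)\<^sup>2)"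
proof (cases "u = 0")
  case False
  define s where "s = u /\<^sub>R norm u"
  have s: "norm s = 1" and us: "u = norm u *\<^sub>R s" using False by (simp_all add: s_def)
  obtain T :: "'a \<Rightarrow> 'a" and B k where T: "orthogonal_transformation T" and B: "B \<subseteq> Basis"
    and k: "bij_betw k B {s}" and Tk: "\<And>b y. b \<in> B \<Longrightarrow> T y \<bullet> k b = y \<bullet> b"
    by (rule orthonormal_to_Basis[of "{s}"]) (auto simp: s pairwise_def intro: that)
  obtain c where c: "c \<in> B" "k c = s" using k by (metis bij_betw_iff_bijections singletonI)
  have "(\<integral>\<^sup>+x. (x \<bullet> u)\<^sup>2 \<partial>CN v) = (\<integral>\<^sup>+x. ennreal (v * (norm u)\<^sup>2) * ennreal ((x \<bullet> s)\<^sup>2) \<partial>CN 1)"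
    using v by (subst nn_integral_CN, simp, subst us)
      (auto simp: power_mult_distrib mult_ac simp flip: ennreal_mult' intro!: nn_integral_cong)
  also have "\<dots> = ennreal (v * (norm u)\<^sup>2) * (\<integral>\<^sup>+x. (x \<bullet> s)\<^sup>2 \<partial>CN 1)"
    by (rule nn_integral_cmult) measurable
  also have "(\<integral>\<^sup>+x. (x \<bullet> s)\<^sup>2 \<partial>CN 1) = (\<integral>\<^sup>+x. (T x \<bullet> s)\<^sup>2 \<partial>CN 1)"
    by (rule nn_integral_CN_orthogonal[OF T, symmetric]) measurable
  also have "\<dots> = (\<integral>\<^sup>+x. (\<Prod>b\<in>Basis. if b = c then (x \<bullet> b)\<^sup>2 else 1) \<partial>CN 1)"
    using Tk[OF c(1)] c B by (auto simp: prod.delta)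
  also have "\<dots> = (\<Prod>b\<in>(Basis::'a set). \<integral>\<^sup>+x. (if b = c then x\<^sup>2 else 1) * (exp (- x\<^sup>2) / sqrt pi) \<partial>lborel)"
    by (rule nn_integral_CN_1_prod[of "\<lambda>b y. if b = c then y\<^sup>2 else 1"]) auto
  also have "\<dots> = (\<Prod>b\<in>(Basis::'a set). if b = c then ennreal (1 / 2) else 1)"
    using nn_integral_exp_square[of 1] nn_integral_square_exp_square
    by (intro prod.cong) (simp_all only: if_True if_False split: if_split, simp_all)
  also have "\<dots> = ennreal (1 / 2)"
    using c B by (subst prod.delta) auto
  finally have "(\<integral>\<^sup>+x. (x \<bullet> u)\<^sup>2 \<partial>CN v) = ennreal (v * (norm u)\<^sup>2) * ennreal (1 / 2)" .
  also have "\<dots> = ennreal (v * (norm u)\<^sup>2 * (1 / 2))" using v by (intro ennreal_mult'[symmetric]) simp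
  finally show ?thesis by simp
qed simp

text \<open>The case \<open>q = 0\<close> is included, both sides being infinite in
  \<open>ennreal\<close>. So vectors whose projection vanishes get no separate treatment.\<close>

lemma inverse_ennreal_eq_nn_integral_exp:
  assumes "0 \<le> q"
  shows "inverse (ennreal q) = (\<integral>\<^sup>+t. ennreal (exp (- t * q)) * indicator {0..} t \<partial>lborel)"
proof (cases "q = 0")
  case True
  have "ennreal (real n) \<le> emeasure lborel {0::real..}" for n
    using emeasure_mono[of "{0..real n}" "{0..}" lborel] by auto
  then have "emeasure lborel {0::real..} = \<infinity>"
    by (metis ennreal_Ex_less_of_nat ennreal_of_nat_eq_real_of_nat infinity_ennreal_def leD less_top)
  then show ?thesis using True by simp
next
  case False
  then have q: "0 < q" using assms by simp
  have lim: "((\<lambda>t. - exp (- t * q) / q) \<longlongrightarrow> - 0 / q) at_top"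
    using q by real_asymp
  have "(\<integral>\<^sup>+t. ennreal (exp (- t * q)) * indicator {0..} t \<partial>lborel) = ennreal (0 - (- exp (- 0 * q) / q))"
    by (rule nn_integral_FTC_atLeast) (use q lim in \<open>auto intro!: derivative_eq_intros\<close>)
  then show ?thesis using q by (simp add: inverse_ennreal field_simps)
qed

text \<open>The antiderivative is \<open>- 1 / (v * (m - 1) * (1 + t * v) ^ (m - 1))\<close>. It
  tends to 0 because \<open>m \<ge> 2\<close>; for \<open>m = 1\<close> the integral
  diverges.\<close>

lemma nn_integral_inverse_power_affine:
  assumes "0 < v" "2 \<le> m"
  shows "(\<integral>\<^sup>+t. ennreal (1 / (1 + t * v) ^ m) * indicator {0..} t \<partial>lborel) = ennreal (1 / (v * (real m - 1)))"
proof -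
  obtain k where m: "m = Suc k" "k \<ge> 1" using assms(2) by (cases m) auto
  have lim: "((\<lambda>t. - 1 / (v * real k * (1 + t * v) ^ k)) \<longlongrightarrow> 0) at_top"
  proof -
    have "filterlim (\<lambda>t. 1 + t * v) at_top at_top" using assms(1) by real_asymp
    then have "filterlim (\<lambda>t. (1 + t * v) ^ k) at_top at_top"
      using m(2) by (intro filterlim_pow_at_top) auto
    then have "filterlim (\<lambda>t. (v * real k) * (1 + t * v) ^ k) at_top at_top"
      using m(2) assms(1) by (intro filterlim_tendsto_pos_mult_at_top[OF tendsto_const]) auto
    then have "((\<lambda>t. inverse ((v * real k) * (1 + t * v) ^ k)) \<longlongrightarrow> 0) at_top"
      by (rule tendsto_inverse_0_at_top)
    then show ?thesis using tendsto_minus by (fastforce simp: field_simps)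
  qed
  have "(\<integral>\<^sup>+t. ennreal (1 / (1 + t * v) ^ m) * indicator {0..} t \<partial>lborel) =
      ennreal (0 - (- 1 / (v * real k * (1 + 0 * v) ^ k)))"
  proof (rule nn_integral_FTC_atLeast)
    fix t :: real assume "0 \<le> t"
    then have p: "0 < 1 + t * v" using assms(1) by (simp add: add_pos_nonneg)
    obtain j where j: "k = Suc j" using m(2) by (cases k) auto
    show "((\<lambda>t. - 1 / (v * real k * (1 + t * v) ^ k)) has_real_derivative 1 / (1 + t * v) ^ m) (at t)"
    proof (rule DERIV_cong)
      show "((\<lambda>t. - 1 / (v * real k * (1 + t * v) ^ k)) has_real_derivative
          (v * real k * (real k * (1 + t * v) ^ (k - 1) * v)) / (v * real k * (1 + t * v) ^ k)\<^sup>2) (at t)"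
        using p assms(1) m(2) by (auto intro!: derivative_eq_intros simp: power2_eq_square)
      show "(v * real k * (real k * (1 + t * v) ^ (k - 1) * v)) / (v * real k * (1 + t * v) ^ k)\<^sup>2 = 1 / (1 + t * v) ^ m"
      proof -
        define w where "w = 1 + t * v"
        have "w > 0" using p by (simp add: w_def)
        then show ?thesis using assms(1) unfolding w_def[symmetric] m(1) j
          by (simp add: power2_eq_square)
      qed
    qed
    show "0 \<le> 1 / (1 + t * v) ^ m" using p by simp
  qed (use lim in auto)
  then show ?thesis using m by (simp add: mult.commute)
qed

text \<open>Tonelli exchanges the Gaussian integral with the integral representation of the inverse.
  In the application \<open>S\<close> is a real orthonormal basis of a space of complex dimension
  \<open>m\<close>, so \<open>card S = 2 * m\<close> turns the square roots into the exponent
  \<open>m\<close>.\<close>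

lemma nn_integral_CN_inverse_orthonormal:
  fixes S :: "'a::euclidean_space set"
  assumes orth: "pairwise orthogonal S" and unit: "\<And>x. x \<in> S \<Longrightarrow> norm x = 1"
    and S: "card S = 2 * m" "2 \<le> m" and v: "0 < v"
  shows "(\<integral>\<^sup>+x. inverse (ennreal (\<Sum>s\<in>S. (x \<bullet> s)\<^sup>2)) \<partial>CN v) = ennreal (1 / (v * (real m - 1)))"
proof -
  interpret CN: prob_space "CN v :: 'a measure" by (rule prob_space_CN)
  interpret pair_sigma_finite "CN v :: 'a measure" "lborel :: real measure" ..
  have "(\<integral>\<^sup>+x. inverse (ennreal (\<Sum>s\<in>S. (x \<bullet> s)\<^sup>2)) \<partial>CN v) =
      (\<integral>\<^sup>+x. \<integral>\<^sup>+t. ennreal (exp (- t * (\<Sum>s\<in>S. (x \<bullet> s)\<^sup>2))) * indicator {0..} t \<partial>lborel \<partial>CN v)"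
    by (simp add: inverse_ennreal_eq_nn_integral_exp sum_nonneg)
  also have "\<dots> = (\<integral>\<^sup>+t. \<integral>\<^sup>+x. ennreal (exp (- t * (\<Sum>s\<in>S. (x \<bullet> s)\<^sup>2))) * indicator {0..} t \<partial>CN v \<partial>lborel)"
    by (rule Fubini'[symmetric]) measurable
  also have "\<dots> = (\<integral>\<^sup>+t. ennreal (1 / (1 + t * v) ^ m) * indicator {0..} t \<partial>lborel)"
  proof (rule nn_integral_cong)
    fix t :: real
    have "1 / sqrt (1 + t * v) ^ card S = 1 / (1 + t * v) ^ m" if "0 \<le> t"
      using that v by (simp add: S(1) power_mult)
    then show "(\<integral>\<^sup>+x. ennreal (exp (- t * (\<Sum>s\<in>S. (x \<bullet> s)\<^sup>2))) * indicator {0..} t \<partial>CN v) =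
        ennreal (1 / (1 + t * v) ^ m) * indicator {0..} t"
      using nn_integral_CN_exp_orthonormal[OF orth unit, of v t] v by (auto simp: nn_integral_multc indicator_def)
  qed
  also have "\<dots> = ennreal (1 / (v * (real m - 1)))"
    by (rule nn_integral_inverse_power_affine[OF v S(2)])
  finally show ?thesis .
qed

section \<open>Linear regression for a pair of Gaussian vectors\<close>

lemma CN_pair:
  "(CN v :: 'a::euclidean_space measure) \<Otimes>\<^sub>M (CN v' :: 'b::euclidean_space measure) =
    distr (CN 1) (borel \<Otimes>\<^sub>M borel) (\<lambda>(x, y). (sqrt v *\<^sub>R x, sqrt v' *\<^sub>R y))"
proof -
  interpret prob_space "distr (CN 1) borel (\<lambda>x::'b. sqrt v' *\<^sub>R x)"
    using prob_space_CN[of v'] unfolding CN_scale[of v'] .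
  \<comment> \<open>Writing each factor as a scaled standard Gaussian covers variance 0, where
    \<open>CN\<close> has no density.\<close>
  show ?thesis
    unfolding CN_scale[of v] CN_scale[of v']
    by (subst pair_measure_distr) (auto simp: CN_1_pair intro: sigma_finite_measure_axioms)
qed

text \<open>In terms of the two standard Gaussian vectors, the regression residual and the sum are the
  images under a rotation of the product space, up to scaling.\<close>

lemma distr_CN_pair_regression:
  fixes b v v' :: real
  defines "s \<equiv> b\<^sup>2 * v + v'"
  assumes v: "0 \<le> v" "0 \<le> v'" and s: "0 < s"
  shows "distr ((CN v :: 'a::euclidean_space measure) \<Otimes>\<^sub>M CN v') (borel \<Otimes>\<^sub>M borel)
           (\<lambda>(x, y). (x - (b * v / s) *\<^sub>R (b *\<^sub>R x + y), b *\<^sub>R x + y)) =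
         CN (v * v' / s) \<Otimes>\<^sub>M CN s"
proof -
  \<comment> \<open>The sum has weights \<open>b * sqrt v\<close> and \<open>sqrt v'\<close> on the
    two standard vectors. Divided by \<open>sqrt s\<close> they form the unit vector
    \<open>(c, d)\<close>, the second row of the rotation; the orthogonal row
    \<open>(d, - c)\<close> yields the residual.\<close>
  define c d where "c = b * sqrt v / sqrt s" and "d = sqrt v' / sqrt s"
  have cd: "c\<^sup>2 + d\<^sup>2 = 1"
    using v s by (simp add: c_def d_def power_divide power_mult_distrib flip: add_divide_distrib) (simp add: s_def)
  define T where "T = (\<lambda>(x::'a, y::'a). (d *\<^sub>R x - c *\<^sub>R y, c *\<^sub>R x + d *\<^sub>R y))"
  have linT: "linear T"
    by (auto simp: linear_iff T_def algebra_simps)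
  have "norm (T p) = norm p" for p
  proof -
    obtain x y where p: "p = (x, y)" by (cases p)
    have "(norm (T p))\<^sup>2 = (c\<^sup>2 + d\<^sup>2) * (x \<bullet> x + y \<bullet> y)"
      unfolding p T_def power2_norm_eq_inner
      by (simp add: inner_simps inner_commute[of y x]) (simp add: algebra_simps power2_eq_square)
    also have "\<dots> = (norm p)\<^sup>2" by (simp add: cd p power2_norm_eq_inner)
    finally show ?thesis by simp
  qed
  then have T: "orthogonal_transformation T" using linT by (simp add: orthogonal_transformation)
  have [measurable]: "T \<in> borel_measurable borel" by (rule borel_measurable_linear[OF linT])
  have [measurable]: "fst \<in> borel \<rightarrow>\<^sub>M (borel :: 'a measure)" "snd \<in> borel \<rightarrow>\<^sub>M (borel :: 'a measure)"
    by (auto intro!: borel_measurable_continuous_onI continuous_intros)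
  \<comment> \<open>The weight of the residual on the first standard vector, by
    \<open>1 - b\<^sup>2 * v / s = v' / s\<close>; the next identity is its weight on the second one
    up to sign.\<close>
  have 1: "sqrt (v * v' / s) * d = sqrt v * (1 - b\<^sup>2 * v / s)"
  proof -
    have "sqrt (v * v' / s) * d = sqrt v * (v' / s)" using v s by (simp add: d_def real_sqrt_mult real_sqrt_divide)
    also have "v' / s = 1 - b\<^sup>2 * v / s" using s by (simp add: field_simps) (simp add: s_def)
    finally show ?thesis .
  qed
  have 2: "sqrt (v * v' / s) * c = b * v / s * sqrt v'"
    using v s by (simp add: c_def real_sqrt_mult real_sqrt_divide)
  have 3: "sqrt s * c = b * sqrt v" "sqrt s * d = sqrt v'"
    using s by (simp_all add: c_def d_def)
  have A: "(sqrt (v * v' / s) *\<^sub>R (d *\<^sub>R x - c *\<^sub>R y), sqrt s *\<^sub>R (c *\<^sub>R x + d *\<^sub>R y)) =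
      (sqrt v *\<^sub>R x - (b * v / s) *\<^sub>R (b *\<^sub>R (sqrt v *\<^sub>R x) + sqrt v' *\<^sub>R y), b *\<^sub>R (sqrt v *\<^sub>R x) + sqrt v' *\<^sub>R y)"
    for x y :: 'a
    unfolding scaleR_diff_right scaleR_add_right scaleR_scaleR 1 2 3
    by (simp add: algebra_simps power2_eq_square)
  have "CN (v * v' / s) \<Otimes>\<^sub>M CN s =
      distr (distr (CN 1) borel T) (borel \<Otimes>\<^sub>M borel) (\<lambda>(x::'a, y::'a). (sqrt (v * v' / s) *\<^sub>R x, sqrt s *\<^sub>R y))"
    by (simp add: CN_pair distr_CN_orthogonal[OF T])
  also have "\<dots> = distr (CN 1) (borel \<Otimes>\<^sub>M borel) (\<lambda>(x::'a, y::'a).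
      (sqrt (v * v' / s) *\<^sub>R (d *\<^sub>R x - c *\<^sub>R y), sqrt s *\<^sub>R (c *\<^sub>R x + d *\<^sub>R y)))"
    by (subst distr_distr) (simp_all add: T_def o_def case_prod_unfold)
  also have "\<dots> = distr (CN 1) (borel \<Otimes>\<^sub>M borel) (\<lambda>(x::'a, y::'a).
      (sqrt v *\<^sub>R x - (b * v / s) *\<^sub>R (b *\<^sub>R (sqrt v *\<^sub>R x) + sqrt v' *\<^sub>R y), b *\<^sub>R (sqrt v *\<^sub>R x) + sqrt v' *\<^sub>R y))"
    unfolding A ..
  also have "\<dots> = distr (CN v \<Otimes>\<^sub>M CN v') (borel \<Otimes>\<^sub>M borel)
           (\<lambda>(x::'a, y). (x - (b * v / s) *\<^sub>R (b *\<^sub>R x + y), b *\<^sub>R x + y))"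
    unfolding CN_pair by (subst distr_distr) (simp_all add: o_def case_prod_unfold)
  finally show ?thesis ..
qed

section \<open>The zero-forcing direction\<close>

text \<open>A proper subspace is a Lebesgue null set, \<open>CN 1\<close> has a density, and scaling
  by \<open>sqrt v > 0\<close> maps the subspace onto itself.\<close>

lemma emeasure_CN_subspace:
  fixes V :: "'a::euclidean_space set"
  assumes V: "subspace V" "dim V < DIM('a)" and v: "0 < v"
  shows "emeasure (CN v) V = 0"
proof -
  have [measurable]: "V \<in> sets borel" using closed_subspace[OF V(1)] by simp
  have "V \<in> null_sets lborel"
    using negligible_lowdim[OF V(2)] by (simp add: negligible_iff_null_sets null_sets_completion_iff)
  have scale: "sqrt v *\<^sub>R x \<in> V \<longleftrightarrow> x \<in> V" for x
  proof
    assume "sqrt v *\<^sub>R x \<in> V"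
    then have "(1 / sqrt v) *\<^sub>R (sqrt v *\<^sub>R x) \<in> V" by (rule subspace_scale[OF V(1)])
    then show "x \<in> V" using v by simp
  qed (rule subspace_scale[OF V(1)])
  have "emeasure (CN v) V = (\<integral>\<^sup>+x. indicator V (sqrt v *\<^sub>R x) \<partial>CN 1)"
    using nn_integral_CN[of "indicator V" v] by (simp add: nn_integral_indicator)
  also have "\<dots> = (\<integral>\<^sup>+x. indicator V x \<partial>CN 1)"
    by (simp add: indicator_def scale)
  also have "\<dots> = 0"
    using AE_not_in[OF \<open>V \<in> null_sets lborel\<close>] unfolding CN_1
    by (subst nn_integral_density) (auto simp: nn_integral_0_iff_AE elim!: AE_mp)
  finally show ?thesis .
qed

section \<open>Hermitian inner products in terms of the real Euclidean structure\<close>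

lemma Re_cinner: "Re (cinner x y) = x \<bullet> y"
  by (simp add: cinner_def inner_vec_def inner_complex_def)

lemma cinner_add_left: "cinner (x + y) z = cinner x z + cinner y z"
  by (simp add: cinner_def algebra_simps sum.distrib)

lemma cinner_scaleR_left: "cinner (c *\<^sub>R x) y = c *\<^sub>R cinner x y"
  by (simp add: cinner_def scaleR_sum_right)

lemma cinner_scaleR_right: "cinner x (c *\<^sub>R y) = c *\<^sub>R cinner x y"
  by (simp add: cinner_def scaleR_sum_right)

lemma cinner_minus_left: "cinner (- x) y = - cinner x y"
  by (simp add: cinner_def sum_negf)

lemma cinner_scale_right: "cinner x (c *s y) = c * cinner x y"
  by (simp add: cinner_def sum_distrib_left mult_ac)

lemma cinner_self: "cinner x x = of_real ((norm x)\<^sup>2)"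
proof -
  have "Im (cinner x x) = 0" by (simp add: cinner_def mult.commute)
  then show ?thesis by (simp add: complex_eq_iff Re_cinner power2_norm_eq_inner)
qed

lemma norm_scale_i: "norm (\<i> *s (x :: complex^'n)) = norm x"
  by (simp add: norm_vec_def norm_mult)

text \<open>Multiplying \<open>y\<close> by \<open>\<i>\<close> turns the imaginary part into a real
  inner product, so a complex projection becomes two real ones along vectors of equal norm.\<close>

lemma cmod_cinner_square: "(cmod (cinner x y))\<^sup>2 = (x \<bullet> y)\<^sup>2 + (x \<bullet> (\<i> *s y))\<^sup>2"
proof -
  have "x \<bullet> (\<i> *s y) = - Im (cinner x y)"
    by (simp flip: Re_cinner add: cinner_scale_right)
  then show ?thesis by (simp add: cmod_power2 Re_cinner)
qed

lemma cinner_matrix_vector: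
  "cinner (A *v x) y = cinner x (ctranspose A *v y)"
proof -
  have "cinner (A *v x) y = (\<Sum>r\<in>UNIV. \<Sum>k\<in>UNIV. cnj (A $ r $ k) * cnj (x $ k) * y $ r)"
    by (simp add: cinner_def matrix_vector_mult_def sum_distrib_right)
  also have "\<dots> = (\<Sum>k\<in>UNIV. \<Sum>r\<in>UNIV. cnj (A $ r $ k) * cnj (x $ k) * y $ r)"
    by (rule sum.swap)
  also have "\<dots> = cinner x (ctranspose A *v y)"
    by (simp add: cinner_def matrix_vector_mult_def ctranspose_def sum_distrib_left mult_ac)
  finally show ?thesis .
qed

lemma ctranspose_mult_vec: "(ctranspose A *v y) $ k = cinner (column k A) y"
  by (simp add: cinner_def matrix_vector_mult_def ctranspose_def column_def)

lemma matrix_vector_scaleR: "A *v (c *\<^sub>R x) = c *\<^sub>R (A *v (x :: complex^'m))"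
  by (simp add: matrix_vector_mult_def vec_eq_iff scaleR_sum_right)

lemma linear_matrix_vector_complex: "linear ((*v) (A :: complex^'m^'n))"
  by (simp add: linear_iff matrix_vector_right_distrib matrix_vector_scaleR)

text \<open>The range is closed under multiplication by \<open>\<i>\<close>, so real orthogonality
  to it is already Hermitian orthogonality. This opens the real theory of orthogonal complements to
  complex matrices.\<close>

lemma cinner_column_eq_0_iff:
  "(\<forall>k. cinner (column k A) y = 0) \<longleftrightarrow> (\<forall>x\<in>range ((*v) A). orthogonal x y)"
proof
  assume *: "\<forall>k. cinner (column k A) y = 0"
  have "ctranspose A *v y = 0" by (simp add: vec_eq_iff ctranspose_mult_vec *)
  then have "cinner (A *v x) y = 0" for x by (simp add: cinner_matrix_vector) (simp add: cinner_def)
  then have "(A *v x) \<bullet> y = 0" for x by (metis Re_cinner zero_complex.simps(1))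
  then show "\<forall>x\<in>range ((*v) A). orthogonal x y" by (auto simp: orthogonal_def)
next
  assume "\<forall>x\<in>range ((*v) A). orthogonal x y"
  then have "Re (cinner x (ctranspose A *v y)) = 0" for x
    by (simp add: orthogonal_def flip: cinner_matrix_vector add: Re_cinner)
  \<comment> \<open>Testing with the vector itself turns the real part into its squared
    norm.\<close>
  from this[of "ctranspose A *v y"] have "ctranspose A *v y = 0"
    by (simp add: cinner_self)
  then show "\<forall>k. cinner (column k A) y = 0" by (metis ctranspose_mult_vec zero_index)
qed

lemma invertible_gram:
  fixes Z :: "complex^'t^'n"
  assumes "\<And>x. Z *v x = 0 \<Longrightarrow> x = 0"
  shows "invertible (ctranspose Z ** Z)"
  unfolding invertible_left_inverse matrix_left_invertible_ker
proof (intro allI impI)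
  fix x assume "(ctranspose Z ** Z) *v x = 0"
  then have "cinner (Z *v x) (Z *v x) = 0"
    by (simp add: cinner_matrix_vector matrix_vector_mul_assoc) (simp add: cinner_def)
  then have "Z *v x = 0" by (simp add: cinner_self)
  then show "x = 0" by (rule assms)
qed

section \<open>The zero-forcing equations and the separation of one column\<close>

lemma matrix_inv_right:
  fixes A :: "'a::field^'n^'n"
  assumes "invertible A"
  shows "A ** matrix_inv A = mat 1"
  using assms unfolding invertible_def matrix_inv_def by (rule someI2_ex) simp

lemma cinner_column_zf_direction:
  assumes "invertible (ctranspose Z ** Z)"
  shows "cinner (column k Z) (zf_direction Z i) = (if k = i then 1 else 0)"
proof -
  have "ctranspose Z *v zf_direction Z i = axis i 1"
    unfolding zf_direction_def
    by (simp add: matrix_vector_mul_assoc matrix_mul_assoc matrix_inv_right[OF assms])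
  then have "(ctranspose Z *v zf_direction Z i) $ k = axis i 1 $ k" by simp
  then show ?thesis by (simp add: ctranspose_mult_vec axis_def)
qed

text \<open>Overwriting keeps the matrix type: \<open>replace_column i 0 Z\<close> stands for the
  other columns without an index type of one element fewer, and \<open>replace_column i x\<close>
  puts a new column back.\<close>

definition replace_column :: "'t \<Rightarrow> 'c^'n \<Rightarrow> 'c^'t^'n \<Rightarrow> 'c^'t^'n" where
  "replace_column i x Z = (\<chi> r k. if k = i then x $ r else Z $ r $ k)"

lemma column_replace_column: "column k (replace_column i x Z) = (if k = i then x else column k Z)"
  by (simp add: column_def replace_column_def vec_eq_iff)

lemma replace_column_replace_column [simp]: "replace_column i x (replace_column i y Z) = replace_column i x Z"
  by (simp add: replace_column_def vec_eq_iff)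

lemma replace_column_column [simp]: "replace_column i (column i Z) Z = Z"
  by (simp add: column_def replace_column_def vec_eq_iff)

lemma replace_column_mult_vec:
  "replace_column i x Z *v y = y $ i *s x + replace_column i 0 Z *v (y :: complex^'t)"
proof -
  have "(replace_column i x Z *v y) $ r = (\<Sum>k\<in>UNIV. (if k = i then y $ i * x $ r else 0) + (if k = i then 0 else Z $ r $ k) * y $ k)" for r
    unfolding matrix_vector_mult_def replace_column_def by (auto intro!: sum.cong)
  moreover have "(replace_column i 0 Z *v y) $ r = (\<Sum>k\<in>UNIV. (if k = i then 0 else Z $ r $ k) * y $ k)" for r
    unfolding matrix_vector_mult_def replace_column_def by (auto intro!: sum.cong)
  ultimately show ?thesis by (simp add: vec_eq_iff sum.distrib)
qed

lemma replace_column_0_mult_vec: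
  "replace_column i 0 Z *v y = Z *v (y - axis i (y $ i :: complex))"
proof -
  have "(\<Sum>k\<in>UNIV. replace_column i 0 Z $ r $ k * y $ k) = (\<Sum>k\<in>UNIV. Z $ r $ k * (y - axis i (y $ i)) $ k)" for r
    by (intro sum.cong) (auto simp: replace_column_def axis_def)
  then show ?thesis by (simp add: matrix_vector_mult_def vec_eq_iff)
qed

text \<open>A kernel equation with nonzero entry \<open>i\<close> can be solved for column
  \<open>i\<close>. Full rank thereby reduces to finitely many conditions, each on one column given
  the others, which is the form that independence can handle.\<close>

lemma independent_columns:
  fixes Z :: "complex^'t^'n"
  assumes "\<And>i. column i Z \<notin> range ((*v) (replace_column i 0 Z))" and "Z *v x = 0"
  shows "x = 0"
proof (rule ccontr)
  assume "x \<noteq> 0"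
  then obtain i where i: "x $ i \<noteq> 0" by (auto simp: vec_eq_iff)
  have "x $ i *s column i Z + replace_column i 0 Z *v x = 0"
    using assms(2) replace_column_mult_vec[of i "column i Z" Z x] by simp
  then have "x $ i *s column i Z = replace_column i 0 Z *v (- x)"
    by (simp add: add_eq_0_iff2 add_eq_0_iff linear_neg[OF linear_matrix_vector_complex])
  moreover have "column i Z = (1 / x $ i) *s (x $ i *s column i Z)" using i by simp
  ultimately have "column i Z = replace_column i 0 Z *v ((1 / x $ i) *s (- x))"
    by (simp only: vector_scalar_commute)
  then show False using assms(1) by blast
qed

text \<open>Zeroing a column amounts to restricting \<open>Z\<close> to a coordinate hyperplane,
  whose dimension an injective \<open>Z\<close> preserves.\<close>

lemma range_replace_column_0:
  "range ((*v) (replace_column i 0 Z)) = (*v) Z ` {x :: complex^'t. x $ i = 0}"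
proof -
  have "(*v) (replace_column i 0 Z) = (*v) Z \<circ> (\<lambda>y. y - axis i (y $ i))"
    by (auto simp: replace_column_0_mult_vec)
  moreover have "range (\<lambda>y. y - axis i (y $ i)) = {x :: complex^'t. x $ i = 0}"
  proof (intro equalityI subsetI)
    fix x :: "complex^'t" assume "x \<in> {x. x $ i = 0}"
    then have "x = x - axis i (x $ i)" by (simp add: vec_eq_iff axis_def)
    then show "x \<in> range (\<lambda>y. y - axis i (y $ i))" by (rule range_eqI)
  qed (auto simp: axis_def)
  ultimately show ?thesis by (simp only: image_comp[symmetric])
qed

text \<open>Dimensions are real: each of the remaining complex coordinates contributes the two basis
  vectors with entry 1 and \<open>\<i>\<close>.\<close>

lemma dim_component_eq_0: "dim {x :: complex^'t. x $ i = 0} = 2 * (CARD('t) - 1)"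
proof -
  define d where "d = (\<lambda>(k, u). axis k u :: complex^'t) ` ((UNIV - {i}) \<times> {1, \<i>})"
  have d: "d \<subseteq> Basis" by (auto simp: d_def Basis_vec_def Basis_complex_def)
  have mem: "axis k u \<in> d \<longleftrightarrow> k \<noteq> i" if "u \<in> {1, \<i>}" for k u
    using that by (auto simp: d_def axis_eq_axis image_iff)
  have "(\<forall>b\<in>Basis. b \<notin> d \<longrightarrow> x \<bullet> b = 0) \<longleftrightarrow> x $ i = 0" for x :: "complex^'t"
  proof
    assume *: "\<forall>b\<in>Basis. b \<notin> d \<longrightarrow> x \<bullet> b = 0"
    have "x $ i \<bullet> u = 0" if "u \<in> {1, \<i>}" for u
      using * that mem[of u i] by (auto simp: Basis_vec_def Basis_complex_def inner_axis)
    from this[of 1] this[of \<i>] show "x $ i = 0" by (simp add: complex_eq_iff inner_complex_def)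
  next
    assume "x $ i = 0"
    then show "\<forall>b\<in>Basis. b \<notin> d \<longrightarrow> x \<bullet> b = 0"
      using mem by (auto simp: Basis_vec_def Basis_complex_def inner_axis)
  qed
  then have "dim {x :: complex^'t. x $ i = 0} = card d"
    using dim_substandard[OF d] by simp
  also have "\<dots> = card ((UNIV - {i}) \<times> {1, \<i>})"
    unfolding d_def by (rule card_image) (auto simp: inj_on_def axis_eq_axis)
  also have "\<dots> = 2 * (CARD('t) - 1)"
    by (simp add: card_cartesian_product card_Diff_singleton)
  finally show ?thesis .
qed

lemma subspace_range_matrix: "subspace (range ((*v) (A :: complex^'m^'n)))"
  by (rule linear_subspace_image[OF linear_matrix_vector_complex subspace_UNIV])

text \<open>The bound holds for every matrix and serves to make the range a null set; the equality
  for injective matrices, below, fixes the dimension of its orthogonal complement.\<close>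

lemma dim_range_replace_column_le:
  "dim (range ((*v) (replace_column i 0 (Z :: complex^'t^'n)))) \<le> 2 * (CARD('t) - 1)"
  unfolding range_replace_column_0
  unfolding dim_component_eq_0[of i, symmetric] by (rule dim_image_le[OF linear_matrix_vector_complex])

lemma dim_range_replace_column:
  fixes Z :: "complex^'t^'n"
  assumes inj: "\<And>x. Z *v x = 0 \<Longrightarrow> x = 0"
  shows "dim (range ((*v) (replace_column i 0 Z))) = 2 * (CARD('t) - 1)"
proof -
  have "inj ((*v) Z)" using inj linear_injective_0[OF linear_matrix_vector_complex] by blast
  then have "inj_on ((*v) Z) (span {x. x $ i = 0})" using inj_on_subset by blast
  then show ?thesis
    unfolding range_replace_column_0
    unfolding dim_component_eq_0[of i, symmetric] by (rule dim_image_eq[OF linear_matrix_vector_complex])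
qed

text \<open>The zero-forcing direction is the component of column \<open>i\<close> orthogonal to the remaining
  columns, divided by its squared norm.\<close>

lemma norm_zf_direction:
  fixes Z :: "complex^'t^'n" and S :: "(complex^'n) set"
  assumes inj: "\<And>x. Z *v x = 0 \<Longrightarrow> x = 0"
    and fin: "finite S" and orth: "pairwise orthogonal S" and unit: "\<And>s. s \<in> S \<Longrightarrow> norm s = 1"
    and span: "span S = {y. \<forall>k. k \<noteq> i \<longrightarrow> cinner (column k Z) y = 0}"
  shows "ennreal ((norm (zf_direction Z i))\<^sup>2) = inverse (ennreal (\<Sum>s\<in>S. (column i Z \<bullet> s)\<^sup>2))"
proof -
  define u where "u = zf_direction Z i"
  define z where "z = column i Z"
  define p where "p = (\<Sum>s\<in>S. (z \<bullet> s) *\<^sub>R s)"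
  define y where "y = matrix_inv (ctranspose Z ** Z) *v axis i 1"
  have Zu: "cinner (column k Z) u = (if k = i then 1 else 0)" for k
    unfolding u_def by (rule cinner_column_zf_direction[OF invertible_gram[OF inj]])
  have uZ: "u = Z *v y" by (simp add: u_def zf_direction_def y_def matrix_vector_mul_assoc)
  \<comment> \<open>As \<open>u\<close> lies in the range of \<open>Z\<close>, pairing it with a
    vector orthogonal to the other columns keeps only the term of column \<open>i\<close>: on
    \<open>span S\<close>, \<open>u\<close> acts as a multiple of \<open>z\<close>.\<close>
  have cu: "cinner u x = cnj (y $ i) * cinner z x" if "x \<in> span S" for x
  proof -
    have "cinner u x = cinner y (ctranspose Z *v x)" by (simp add: uZ cinner_matrix_vector)
    also have "\<dots> = (\<Sum>k\<in>UNIV. cnj (y $ k) * cinner (column k Z) x)"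
      by (simp add: cinner_def[of y] ctranspose_mult_vec)
    also have "\<dots> = (\<Sum>k\<in>UNIV. if k = i then cnj (y $ i) * cinner z x else 0)"
      using that by (intro sum.cong) (auto simp: span z_def)
    finally show ?thesis by simp
  qed
  have uS: "u \<in> span S" using Zu by (simp add: span)
  have pS: "p \<in> span S" by (simp add: p_def span_sum span_mul span_base)
  \<comment> \<open>Taking \<open>x = u\<close>, where \<open>cinner z u = 1\<close>, identifies the
    factor.\<close>
  have "cnj (y $ i) = of_real ((norm u)\<^sup>2)" using cu[OF uS] Zu[of i] by (simp add: cinner_self z_def)
  then have ux: "u \<bullet> x = (norm u)\<^sup>2 * (z \<bullet> x)" if "x \<in> span S" for x
  proof -
    have "cinner u x = of_real ((norm u)\<^sup>2) * cinner z x"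
      using cu[OF that] \<open>cnj (y $ i) = _\<close> by simp
    then have "Re (cinner u x) = (norm u)\<^sup>2 * Re (cinner z x)" by (simp only: Re_complex_of_real times_complex.sel Im_complex_of_real)
    then show ?thesis by (simp add: Re_cinner)
  qed
  have pz: "p \<bullet> x = z \<bullet> x" if "x \<in> span S" for x
    using that
  proof (induction rule: span_induct_alt)
    case (step c s x)
    have "p \<bullet> s = (\<Sum>s'\<in>S. (z \<bullet> s') * (s' \<bullet> s))" by (simp add: p_def inner_sum_left)
    also have "\<dots> = (\<Sum>s'\<in>S. if s' = s then z \<bullet> s else 0)"
      using step(1) orth unit
      by (intro sum.cong) (auto simp: pairwise_def orthogonal_def norm_eq_1)
    finally show ?case using step fin by (simp add: inner_add_right)
  qed simp
  have zu: "z \<bullet> u = 1" using Zu[of i] by (simp add: z_def flip: Re_cinner)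
  have zp: "z \<bullet> p = (\<Sum>s\<in>S. (z \<bullet> s)\<^sup>2)" by (simp add: p_def inner_sum_right power2_eq_square)
  \<comment> \<open>\<open>p\<close> is the projection of \<open>z\<close> onto
    \<open>span S\<close>. Evaluated through \<open>p\<close>, the inner product
    \<open>p \<bullet> u\<close> is 1; through \<open>u\<close>, it is
    \<open>(norm u)\<^sup>2\<close> times the squared length of \<open>p\<close>.\<close>
  have "1 = p \<bullet> u" using pz[OF uS] zu by simp
  also have "\<dots> = (norm u)\<^sup>2 * (\<Sum>s\<in>S. (z \<bullet> s)\<^sup>2)" using ux[OF pS] by (simp only: inner_commute[of p u] zp)
  finally have 1: "(norm u)\<^sup>2 * (\<Sum>s\<in>S. (z \<bullet> s)\<^sup>2) = 1" ..
  then have "(\<Sum>s\<in>S. (z \<bullet> s)\<^sup>2) > 0" by (metis mult_zero_right sum_nonneg zero_le_power2 zero_neq_one less_eq_real_def)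
  then show ?thesis using 1 unfolding u_def z_def
    by (simp add: inverse_ennreal inverse_eq_divide eq_divide_eq)
qed

text \<open>\<open>S\<close> depends only on the columns other than \<open>i\<close>, so one
  \<open>S\<close> serves all new columns \<open>x\<close> outside their span, and the inverse
  moment can be taken over \<open>x\<close> with the rest fixed. Its size is twice the complex
  dimension \<open>CARD('n) - CARD('t) + 1\<close>.\<close>

lemma norm_zf_direction_replace_column:
  fixes Z :: "complex^'t^'n" and i :: 't
  assumes inj: "\<And>x. Z *v x = 0 \<Longrightarrow> x = 0"
  obtains S :: "(complex^'n) set" where "pairwise orthogonal S" "\<And>s. s \<in> S \<Longrightarrow> norm s = 1"
    "card S + 2 * (CARD('t) - 1) = 2 * CARD('n)"
    "\<And>x. x \<notin> range ((*v) (replace_column i 0 Z)) \<Longrightarrow>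
      ennreal ((norm (zf_direction (replace_column i x Z) i))\<^sup>2) = inverse (ennreal (\<Sum>s\<in>S. (x \<bullet> s)\<^sup>2))"
proof -
  define R where "R = replace_column i 0 Z"
  define W where "W = {y \<in> UNIV. \<forall>x \<in> range ((*v) R). orthogonal x y}"
  have W: "W = {y. \<forall>k. k \<noteq> i \<longrightarrow> cinner (column k Z) y = 0}"
    unfolding W_def cinner_column_eq_0_iff[symmetric] R_def column_replace_column by (auto simp: cinner_def)
  have "subspace W"
    unfolding W_def using subspace_orthogonal_to_vectors[of "range ((*v) R)"] by (simp add: orthogonal_commute)
  then obtain S where S: "S \<subseteq> W" "pairwise orthogonal S" "\<And>x. x \<in> S \<Longrightarrow> norm x = 1"
      "independent S" "card S = dim W" "span S = W"
    using orthonormal_basis_subspace by metis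
  have "dim W + dim (range ((*v) R)) = dim (UNIV :: (complex^'n) set)"
    unfolding W_def by (rule dim_subspace_orthogonal_to_vectors) (auto intro: subspace_range_matrix)
  then have card: "card S + 2 * (CARD('t) - 1) = 2 * CARD('n)"
    using S(5) dim_range_replace_column[of Z i, OF inj] by (simp add: R_def mult.commute)
  have *: "ennreal ((norm (zf_direction (replace_column i x Z) i))\<^sup>2) = inverse (ennreal (\<Sum>s\<in>S. (x \<bullet> s)\<^sup>2))"
    if x: "x \<notin> range ((*v) R)" for x
  proof -
    \<comment> \<open>The new matrix has full rank: a kernel vector with \<open>y $ i = 0\<close> is
      in the kernel of \<open>Z\<close>, any other would put \<open>x\<close> into the range of
      \<open>R\<close>.\<close>
    have "y = 0" if "replace_column i x Z *v y = 0" for y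
    proof (cases "y $ i = 0")
      case True
      have ax: "axis i 0 = (0 :: complex^'t)" by (simp add: vec_eq_iff axis_def)
      have "Z *v y = 0"
        using that replace_column_mult_vec[of i x Z y] replace_column_0_mult_vec[of i Z y]
        by (simp only: True ax diff_zero vector_smult_lzero add_0)
      then show ?thesis by (rule inj)
    next
      case False
      have "y $ i *s x + R *v y = 0"
        using that replace_column_mult_vec[of i x Z y] by (simp only: R_def)
      then have "y $ i *s x = R *v (- y)"
        by (simp only: eq_neg_iff_add_eq_0 linear_neg[OF linear_matrix_vector_complex])
      moreover have "x = (1 / y $ i) *s (y $ i *s x)" using False by simp
      ultimately have "x = R *v ((1 / y $ i) *s (- y))" by (simp only: vector_scalar_commute)
      then show ?thesis using x by blast
    qed
    then show ?thesis
      using norm_zf_direction[of "replace_column i x Z" S i, OF _ independent_imp_finite[OF S(4)] S(2,3)] S(6)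
      by (simp add: W column_replace_column cong: imp_cong)
  qed
  show thesis
  proof (rule that)
    show "pairwise orthogonal S" "card S + 2 * (CARD('t) - 1) = 2 * CARD('n)" by fact+
    show "norm s = 1" if "s \<in> S" for s using that by (rule S(3))
    show "ennreal ((norm (zf_direction (replace_column i x Z) i))\<^sup>2) = inverse (ennreal (\<Sum>s\<in>S. (x \<bullet> s)\<^sup>2))"
      if "x \<notin> range ((*v) (replace_column i 0 Z))" for x
      using * that by (simp only: R_def)
  qed
qed

section \<open>Gaussian matrices with independent columns\<close>

lemma continuous_on_det [continuous_intros]:
  fixes A :: "'a::topological_space \<Rightarrow> complex^'n^'n"
  assumes "continuous_on S A"
  shows "continuous_on S (\<lambda>x. det (A x))"
  unfolding det_def using assms by (intro continuous_intros) auto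

lemma continuous_on_matrix_mult [continuous_intros]:
  fixes A :: "'a::topological_space \<Rightarrow> complex^'m^'n"
  assumes "continuous_on S A" "continuous_on S B"
  shows "continuous_on S (\<lambda>x. A x ** B x)"
  unfolding matrix_matrix_mult_def using assms by (intro continuous_intros)

lemma continuous_on_matrix_vector_mult [continuous_intros]:
  fixes A :: "'a::topological_space \<Rightarrow> complex^'m^'n"
  assumes "continuous_on S A" "continuous_on S x"
  shows "continuous_on S (\<lambda>y. A y *v x y)"
  unfolding matrix_vector_mult_def using assms by (intro continuous_intros)

lemma continuous_on_ctranspose [continuous_intros]:
  assumes "continuous_on S A"
  shows "continuous_on S (\<lambda>x. ctranspose (A x))"
  unfolding ctranspose_def using assms by (intro continuous_intros)

lemma borel_measurable_cinner [measurable]: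
  assumes "f \<in> borel_measurable M" "g \<in> borel_measurable M"
  shows "(\<lambda>x. cinner (f x) (g x)) \<in> borel_measurable M"
proof (rule borel_measurable_continuous_Pair[OF assms])
  show "continuous_on UNIV (\<lambda>x. cinner (fst x) (snd x))"
    unfolding cinner_def by (intro continuous_intros)
qed

lemma borel_measurable_column [measurable]:
  "(column i :: complex^'t^'n \<Rightarrow> complex^'n) \<in> borel_measurable borel"
  unfolding column_def by (intro borel_measurable_continuous_onI continuous_intros)

lemma borel_measurable_replace_column [measurable]:
  fixes Z :: "'a \<Rightarrow> complex^'t^'n"
  assumes "x \<in> borel_measurable M" "Z \<in> borel_measurable M"
  shows "(\<lambda>\<omega>. replace_column i (x \<omega>) (Z \<omega>)) \<in> borel_measurable M"
proof (rule borel_measurable_continuous_Pair[OF assms, where H = "replace_column i"])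
  have "continuous_on UNIV (\<lambda>p :: (complex^'n) \<times> (complex^'t^'n). if k = i then fst p $ r else snd p $ r $ k)" for k r
    by (cases "k = i") (auto intro!: continuous_intros)
  then show "continuous_on UNIV (\<lambda>p :: (complex^'n) \<times> (complex^'t^'n). replace_column i (fst p) (snd p))"
    unfolding replace_column_def by (intro continuous_on_vec_lambda)
qed

text \<open>\<open>matrix_inv\<close> is defined by choice. Cramer's rule replaces it by a rational
  formula where the Gram determinant is nonzero; elsewhere it is one constant.\<close>

lemma borel_measurable_zf_direction:
  "(\<lambda>Z :: complex^'t^'n. zf_direction Z i) \<in> borel_measurable borel"
proof -
  define G where "G = (\<lambda>Z :: complex^'t^'n. ctranspose Z ** Z)"
  define c where "c = (\<lambda>Z k. det (\<chi> a b. if b = k then axis i 1 $ a else G Z $ a $ b))"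
  \<comment> \<open>On a singular matrix the predicate inside \<open>matrix_inv\<close> is
    constantly false, so all singular matrices get this same value.\<close>
  define C where "C = (SOME A' :: complex^'t^'t. False)"
  have contG: "continuous_on UNIV G" unfolding G_def by (intro continuous_intros)
  have "continuous_on UNIV (\<lambda>Z. if b = k then axis i 1 $ a else G Z $ a $ b)" for a b k
    using contG by (cases "b = k") (auto intro!: continuous_intros)
  then have contc: "continuous_on UNIV (\<lambda>Z. c Z k)" for k
    unfolding c_def by (intro continuous_on_det continuous_on_vec_lambda)
  have eq: "zf_direction Z i = (if det (G Z) = 0 then (Z ** C) *v axis i 1 else (1 / det (G Z)) *s (Z *v (\<chi> k. c Z k)))" for Z
  proof (cases "det (G Z) = 0")
    case True
    then have "\<not> invertible (G Z)" by (simp add: invertible_det_nz)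
    then have "(\<lambda>A'. G Z ** A' = mat 1 \<and> A' ** G Z = mat 1) = (\<lambda>A'. False)"
      by (auto simp: invertible_def fun_eq_iff)
    then have "matrix_inv (G Z) = C" unfolding matrix_inv_def C_def by simp
    then show ?thesis using True by (simp add: zf_direction_def G_def)
  next
    case False
    then have "invertible (G Z)" by (simp add: invertible_det_nz)
    then have "G Z *v (matrix_inv (G Z) *v axis i 1) = axis i 1"
      by (simp add: matrix_vector_mul_assoc matrix_inv_right)
    then have "matrix_inv (G Z) *v axis i 1 = (\<chi> k. c Z k / det (G Z))"
      unfolding cramer[OF False] c_def .
    moreover have "(\<chi> k. c Z k / det (G Z)) = (1 / det (G Z)) *s (\<chi> k. c Z k)"
      by (simp add: vec_eq_iff)
    ultimately have "matrix_inv (G Z) *v axis i 1 = (1 / det (G Z)) *s (\<chi> k. c Z k)" by simp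
    then show ?thesis using False
      by (simp add: zf_direction_def G_def flip: matrix_vector_mul_assoc add: vector_scalar_commute)
  qed
  have [measurable]: "(\<lambda>Z. det (G Z)) \<in> borel_measurable borel"
    by (intro borel_measurable_continuous_onI continuous_on_det contG)
  have [measurable]: "(\<lambda>Z :: complex^'t^'n. (Z ** C) *v axis i 1) \<in> borel_measurable borel"
    by (intro borel_measurable_continuous_onI continuous_intros)
  have [measurable]: "(\<lambda>Z. Z *v (\<chi> k. c Z k)) \<in> borel_measurable borel"
    by (intro borel_measurable_continuous_onI continuous_intros contc)
  have [measurable]: "(\<lambda>Z. (1 / det (G Z)) *s (Z *v (\<chi> k. c Z k))) \<in> borel_measurable borel"
  proof (rule borel_measurable_continuous_Pair[where H = "(*s)"])
    show "continuous_on UNIV (\<lambda>p :: complex \<times> (complex^'n). fst p *s snd p)"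
      unfolding vector_scalar_mult_def by (intro continuous_intros)
  qed measurable
  show ?thesis unfolding eq by measurable
qed

lemma measurable_zf_direction [measurable]:
  fixes Z :: "'a \<Rightarrow> complex^'t^'n"
  assumes "Z \<in> borel_measurable M"
  shows "(\<lambda>x. zf_direction (Z x) i) \<in> borel_measurable M"
  using measurable_compose[OF assms borel_measurable_zf_direction] .

lemma pred_in_column_range [measurable (raw)]:
  fixes Z :: "'a \<Rightarrow> complex^'t^'n"
  assumes [measurable]: "x \<in> borel_measurable M" "Z \<in> borel_measurable M"
  shows "Measurable.pred M (\<lambda>\<omega>. x \<omega> \<in> range ((*v) (Z \<omega>)))"
proof -
  \<comment> \<open>A countable dense set of coefficient vectors suffices, because the range is closed.\<close>
  obtain D :: "(complex^'t) set" where D: "countable D" "\<And>X. open X \<Longrightarrow> X \<noteq> {} \<Longrightarrow> \<exists>d\<in>D. d \<in> X"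
    using countable_dense_exists by blast
  have eq: "v \<in> range ((*v) A) \<longleftrightarrow> (\<forall>n. \<exists>d\<in>D. norm (v - A *v d) < 1 / real (Suc n))" for v and A :: "complex^'t^'n"
  proof
    assume "v \<in> range ((*v) A)"
    then obtain y where y: "v = A *v y" by blast
    show "\<forall>n. \<exists>d\<in>D. norm (v - A *v d) < 1 / real (Suc n)"
    proof
      fix n
      have "continuous_on UNIV (\<lambda>d. norm (v - A *v d))" by (intro continuous_intros)
      then have "open {d. norm (v - A *v d) < 1 / real (Suc n)}"
        by (intro open_Collect_less continuous_on_const)
      moreover have "y \<in> {d. norm (v - A *v d) < 1 / real (Suc n)}" by (simp add: y)
      ultimately show "\<exists>d\<in>D. norm (v - A *v d) < 1 / real (Suc n)" using D(2) by blast
    qed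
  next
    assume *: "\<forall>n. \<exists>d\<in>D. norm (v - A *v d) < 1 / real (Suc n)"
    have "v \<in> closure (range ((*v) A))"
      unfolding closure_approachable
    proof (intro allI impI)
      fix e :: real assume "0 < e"
      then obtain n where "1 / real (Suc n) < e" using nat_approx_posE by metis
      moreover obtain d where "norm (v - A *v d) < 1 / real (Suc n)" using * by blast
      ultimately show "\<exists>y\<in>range ((*v) A). dist y v < e"
        by (intro bexI[of _ "A *v d"]) (auto simp: dist_norm norm_minus_commute)
    qed
    then show "v \<in> range ((*v) A)"
      using closed_subspace[OF subspace_range_matrix[of A]] by simp
  qed
  have [measurable]: "(\<lambda>\<omega>. Z \<omega> *v d) \<in> borel_measurable M" for d
    by (rule measurable_compose[OF assms(2)])
      (intro borel_measurable_continuous_onI continuous_intros)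
  show ?thesis unfolding eq using D(1) by measurable
qed

text \<open>The other columns span real dimension at most \<open>2 * (CARD('t) - 1)\<close>, which
  is less than \<open>2 * CARD('n)\<close>.\<close>

lemma AE_CN_notin_range_replace_column:
  assumes "0 < v" and "CARD('t) + 1 \<le> CARD('n)"
  shows "AE x in CN v. x \<notin> range ((*v) (replace_column i 0 (R :: complex^'t^'n)))"
proof -
  have "dim (range ((*v) (replace_column i 0 R))) < DIM(complex^'n)"
    using dim_range_replace_column_le[of i R] assms(2) by simp
  then have "emeasure (CN v) (range ((*v) (replace_column i 0 R))) = 0"
    by (rule emeasure_CN_subspace[OF subspace_range_matrix _ assms(1)])
  moreover have "range ((*v) (replace_column i 0 R)) \<in> sets (CN v)"
    using closed_subspace[OF subspace_range_matrix[of "replace_column i 0 R"]] by simp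
  ultimately show ?thesis by (intro AE_not_in) auto
qed

text \<open>Independence of two random elements of possibly different types, which \<open>indep_var\<close> does
  not allow.\<close>

definition indep_pair :: "'w measure \<Rightarrow> 'b measure \<Rightarrow> ('w \<Rightarrow> 'b) \<Rightarrow> 'c measure \<Rightarrow> ('w \<Rightarrow> 'c) \<Rightarrow> bool" where
  "indep_pair M S X T Y \<longleftrightarrow> X \<in> M \<rightarrow>\<^sub>M S \<and> Y \<in> M \<rightarrow>\<^sub>M T \<and>
     distr M S X \<Otimes>\<^sub>M distr M T Y = distr M (S \<Otimes>\<^sub>M T) (\<lambda>\<omega>. (X \<omega>, Y \<omega>))"

section \<open>Independence and expectations of Gaussian projections\<close>

context prob_space begin

lemma indep_pair_compose:
  assumes ind: "indep_pair M S X T Y" and f: "f \<in> S \<rightarrow>\<^sub>M S'" and g: "g \<in> T \<rightarrow>\<^sub>M T'"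
  shows "indep_pair M S' (\<lambda>\<omega>. f (X \<omega>)) T' (\<lambda>\<omega>. g (Y \<omega>))"
proof -
  have X: "X \<in> M \<rightarrow>\<^sub>M S" and Y: "Y \<in> M \<rightarrow>\<^sub>M T" using ind by (auto simp: indep_pair_def)
  note [measurable] = X Y f g
  interpret Y': prob_space "distr M T' (\<lambda>\<omega>. g (Y \<omega>))" by (rule prob_space_distr) measurable
  have "distr M S' (\<lambda>\<omega>. f (X \<omega>)) \<Otimes>\<^sub>M distr M T' (\<lambda>\<omega>. g (Y \<omega>)) =
      distr (distr M S X) S' f \<Otimes>\<^sub>M distr (distr M T Y) T' g"
    by (simp add: distr_distr o_def)
  also have "\<dots> = distr (distr M S X \<Otimes>\<^sub>M distr M T Y) (S' \<Otimes>\<^sub>M T') (\<lambda>(x, y). (f x, g y))"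
    by (rule pair_measure_distr) (auto simp: distr_distr o_def intro: Y'.sigma_finite_measure_axioms)
  also have "distr M S X \<Otimes>\<^sub>M distr M T Y = distr M (S \<Otimes>\<^sub>M T) (\<lambda>\<omega>. (X \<omega>, Y \<omega>))"
    using ind by (simp add: indep_pair_def)
  also have "distr \<dots> (S' \<Otimes>\<^sub>M T') (\<lambda>(x, y). (f x, g y)) = distr M (S' \<Otimes>\<^sub>M T') (\<lambda>\<omega>. (f (X \<omega>), g (Y \<omega>)))"
    by (subst distr_distr) (auto simp: o_def)
  finally show ?thesis by (simp add: indep_pair_def)
qed

text \<open>Both measures agree on rectangles, which determine a product of sigma-finite
  measures.\<close>

lemma indep_pairI_indep_set:
  assumes ind: "indep_set \<A> \<B>" and [measurable]: "X \<in> M \<rightarrow>\<^sub>M S" "Y \<in> M \<rightarrow>\<^sub>M T"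
    and X: "\<And>A. A \<in> sets S \<Longrightarrow> X -` A \<inter> space M \<in> \<A>"
    and Y: "\<And>B. B \<in> sets T \<Longrightarrow> Y -` B \<inter> space M \<in> \<B>"
  shows "indep_pair M S X T Y"
proof -
  interpret X': prob_space "distr M S X" by (rule prob_space_distr) measurable
  interpret Y': prob_space "distr M T Y" by (rule prob_space_distr) measurable
  have "distr M S X \<Otimes>\<^sub>M distr M T Y = distr M (S \<Otimes>\<^sub>M T) (\<lambda>\<omega>. (X \<omega>, Y \<omega>))"
  proof (rule pair_measure_eqI)
    fix A B assume "A \<in> sets (distr M S X)" "B \<in> sets (distr M T Y)"
    then have AB [measurable]: "A \<in> sets S" "B \<in> sets T" by simp_all
    have eq: "(\<lambda>\<omega>. (X \<omega>, Y \<omega>)) -` (A \<times> B) \<inter> space M = (X -` A \<inter> space M) \<inter> (Y -` B \<inter> space M)" by auto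
    have "prob ((X -` A \<inter> space M) \<inter> (Y -` B \<inter> space M)) = prob (X -` A \<inter> space M) * prob (Y -` B \<inter> space M)"
      by (intro indep_setD[OF ind] X Y AB)
    then show "emeasure (distr M S X) A * emeasure (distr M T Y) B =
        emeasure (distr M (S \<Otimes>\<^sub>M T) (\<lambda>\<omega>. (X \<omega>, Y \<omega>))) (A \<times> B)"
      by (simp add: emeasure_distr eq emeasure_eq_measure ennreal_mult)
  qed (auto intro: X'.sigma_finite_measure_axioms Y'.sigma_finite_measure_axioms cong: sets_pair_measure_cong)
  then show ?thesis by (simp add: indep_pair_def)
qed

text \<open>Both sides are the triple product measure up to bracketing. It is applied to a residual,
  its own column and the remaining columns, to make the residual independent of the whole
  matrix.\<close>

lemma indep_pair_assoc:
  assumes XY: "indep_pair M S X T Y" and XYW: "indep_pair M (S \<Otimes>\<^sub>M T) (\<lambda>\<omega>. (X \<omega>, Y \<omega>)) U W"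
  shows "indep_pair M S X (T \<Otimes>\<^sub>M U) (\<lambda>\<omega>. (Y \<omega>, W \<omega>))"
proof -
  have [measurable]: "X \<in> M \<rightarrow>\<^sub>M S" "Y \<in> M \<rightarrow>\<^sub>M T" "W \<in> M \<rightarrow>\<^sub>M U"
    using XY XYW by (auto simp: indep_pair_def)
  have YW: "indep_pair M T Y U W"
    using indep_pair_compose[OF XYW, of snd T "\<lambda>w. w" U] by simp
  interpret X': prob_space "distr M S X" by (rule prob_space_distr) measurable
  interpret Y': prob_space "distr M T Y" by (rule prob_space_distr) measurable
  interpret W': prob_space "distr M U W" by (rule prob_space_distr) measurable
  interpret YW': prob_space "distr M (T \<Otimes>\<^sub>M U) (\<lambda>\<omega>. (Y \<omega>, W \<omega>))" by (rule prob_space_distr) measurable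
  have "distr M S X \<Otimes>\<^sub>M distr M (T \<Otimes>\<^sub>M U) (\<lambda>\<omega>. (Y \<omega>, W \<omega>)) =
      distr M (S \<Otimes>\<^sub>M (T \<Otimes>\<^sub>M U)) (\<lambda>\<omega>. (X \<omega>, (Y \<omega>, W \<omega>)))"
  proof (rule measure_eqI)
    show "sets (distr M S X \<Otimes>\<^sub>M distr M (T \<Otimes>\<^sub>M U) (\<lambda>\<omega>. (Y \<omega>, W \<omega>))) =
        sets (distr M (S \<Otimes>\<^sub>M (T \<Otimes>\<^sub>M U)) (\<lambda>\<omega>. (X \<omega>, (Y \<omega>, W \<omega>))))"
      by (simp cong: sets_pair_measure_cong)
    fix A assume "A \<in> sets (distr M S X \<Otimes>\<^sub>M distr M (T \<Otimes>\<^sub>M U) (\<lambda>\<omega>. (Y \<omega>, W \<omega>)))"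
    then have A [measurable]: "A \<in> sets (S \<Otimes>\<^sub>M (T \<Otimes>\<^sub>M U))" by (simp cong: sets_pair_measure_cong)
    have "emeasure (distr M S X \<Otimes>\<^sub>M distr M (T \<Otimes>\<^sub>M U) (\<lambda>\<omega>. (Y \<omega>, W \<omega>))) A =
        (\<integral>\<^sup>+p. indicator A p \<partial>(distr M S X \<Otimes>\<^sub>M distr M (T \<Otimes>\<^sub>M U) (\<lambda>\<omega>. (Y \<omega>, W \<omega>))))"
      by (rule nn_integral_indicator[symmetric]) (simp cong: sets_pair_measure_cong)
    also have "\<dots> = (\<integral>\<^sup>+x. \<integral>\<^sup>+q. indicator A (x, q) \<partial>distr M (T \<Otimes>\<^sub>M U) (\<lambda>\<omega>. (Y \<omega>, W \<omega>)) \<partial>distr M S X)"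
      by (rule YW'.nn_integral_fst[symmetric]) (simp cong: measurable_cong_sets)
    also have "\<dots> = (\<integral>\<^sup>+x. \<integral>\<^sup>+y. \<integral>\<^sup>+w. indicator A (x, (y, w)) \<partial>distr M U W \<partial>distr M T Y \<partial>distr M S X)"
    proof (rule nn_integral_cong)
      fix x assume "x \<in> space (distr M S X)"
      then have [simp]: "x \<in> space S" by simp
      show "(\<integral>\<^sup>+q. indicator A (x, q) \<partial>distr M (T \<Otimes>\<^sub>M U) (\<lambda>\<omega>. (Y \<omega>, W \<omega>))) =
          (\<integral>\<^sup>+y. \<integral>\<^sup>+w. indicator A (x, (y, w)) \<partial>distr M U W \<partial>distr M T Y)"
        using YW unfolding indep_pair_def
        by (subst W'.nn_integral_fst[of "\<lambda>q. indicator A (x, q)"]) auto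
    qed
    also have "\<dots> = (\<integral>\<^sup>+q. \<integral>\<^sup>+w. indicator A (fst q, (snd q, w)) \<partial>distr M U W \<partial>(distr M S X \<Otimes>\<^sub>M distr M T Y))"
      by (subst Y'.nn_integral_fst[symmetric]) auto
    also have "\<dots> = (\<integral>\<^sup>+p. indicator A (fst (fst p), (snd (fst p), snd p)) \<partial>((distr M S X \<Otimes>\<^sub>M distr M T Y) \<Otimes>\<^sub>M distr M U W))"
      by (subst W'.nn_integral_fst[symmetric]) auto
    also have "(distr M S X \<Otimes>\<^sub>M distr M T Y) \<Otimes>\<^sub>M distr M U W = distr M ((S \<Otimes>\<^sub>M T) \<Otimes>\<^sub>M U) (\<lambda>\<omega>. ((X \<omega>, Y \<omega>), W \<omega>))"
      using XY XYW by (simp add: indep_pair_def)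
    also have "(\<integral>\<^sup>+p. indicator A (fst (fst p), (snd (fst p), snd p)) \<partial>\<dots>) =
        (\<integral>\<^sup>+\<omega>. indicator A (X \<omega>, (Y \<omega>, W \<omega>)) \<partial>M)"
      by (subst nn_integral_distr) auto
    also have "\<dots> = (\<integral>\<^sup>+p. indicator A p \<partial>distr M (S \<Otimes>\<^sub>M (T \<Otimes>\<^sub>M U)) (\<lambda>\<omega>. (X \<omega>, (Y \<omega>, W \<omega>))))"
      by (subst nn_integral_distr) auto
    also have "\<dots> = emeasure (distr M (S \<Otimes>\<^sub>M (T \<Otimes>\<^sub>M U)) (\<lambda>\<omega>. (X \<omega>, (Y \<omega>, W \<omega>)))) A"
      by (rule nn_integral_indicator) simp
    finally show "emeasure (distr M S X \<Otimes>\<^sub>M distr M (T \<Otimes>\<^sub>M U) (\<lambda>\<omega>. (Y \<omega>, W \<omega>))) A =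
      emeasure (distr M (S \<Otimes>\<^sub>M (T \<Otimes>\<^sub>M U)) (\<lambda>\<omega>. (X \<omega>, (Y \<omega>, W \<omega>)))) A" .
  qed
  then show ?thesis by (simp add: indep_pair_def)
qed

text \<open>\<open>b * v / s\<close> is the regression coefficient, covariance over variance, and
  \<open>v * v' / s\<close> the variance left over. That the uncorrelated residual is even
  independent comes from the rotation of the pair.\<close>

lemma indep_pair_CN_regression:
  fixes X Y :: "'a \<Rightarrow> 'b::euclidean_space"
  assumes ind: "indep_pair M borel X borel Y" and X: "distr M borel X = CN v" and Y: "distr M borel Y = CN v'"
    and v: "0 \<le> v" "0 \<le> v'" and s: "s = b\<^sup>2 * v + v'" "0 < s"
  defines "Z \<equiv> \<lambda>\<omega>. b *\<^sub>R X \<omega> + Y \<omega>"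
  defines "e \<equiv> \<lambda>\<omega>. X \<omega> - (b * v / s) *\<^sub>R Z \<omega>"
  shows "indep_pair M borel e borel Z" "distr M borel e = CN (v * v' / s)" "distr M borel Z = CN s"
proof -
  have [measurable]: "X \<in> borel_measurable M" "Y \<in> borel_measurable M"
    using ind by (auto simp: indep_pair_def)
  have [measurable]: "Z \<in> borel_measurable M" "e \<in> borel_measurable M"
    unfolding e_def Z_def by measurable
  interpret A: prob_space "CN (v * v' / s) :: 'b measure" by (rule prob_space_CN)
  interpret B: prob_space "CN s :: 'b measure" by (rule prob_space_CN)
  have eq: "distr M (borel \<Otimes>\<^sub>M borel) (\<lambda>\<omega>. (e \<omega>, Z \<omega>)) = CN (v * v' / s) \<Otimes>\<^sub>M CN s"
  proof -
    have "distr M (borel \<Otimes>\<^sub>M borel) (\<lambda>\<omega>. (e \<omega>, Z \<omega>)) =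
      distr (distr M (borel \<Otimes>\<^sub>M borel) (\<lambda>\<omega>. (X \<omega>, Y \<omega>))) (borel \<Otimes>\<^sub>M borel)
           (\<lambda>(x, y). (x - (b * v / s) *\<^sub>R (b *\<^sub>R x + y), b *\<^sub>R x + y))"
      by (subst distr_distr) (auto simp: o_def e_def Z_def)
    also have "\<dots> = CN (v * v' / s) \<Otimes>\<^sub>M CN s"
      using ind distr_CN_pair_regression[of v v' b, where 'a = 'b] v s by (simp add: indep_pair_def X Y)
    finally show ?thesis .
  qed
  have "distr M borel e = distr (distr M (borel \<Otimes>\<^sub>M borel) (\<lambda>\<omega>. (e \<omega>, Z \<omega>))) borel fst"
    by (subst distr_distr) (auto simp: o_def)
  also have "\<dots> = distr (CN (v * v' / s) \<Otimes>\<^sub>M (CN s :: 'b measure)) (CN (v * v' / s)) fst"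
    unfolding eq by (rule distr_cong) simp_all
  also have "\<dots> = CN (v * v' / s)" by (rule B.distr_pair_fst)
  finally show 1: "distr M borel e = CN (v * v' / s)" .
  show 2: "distr M borel Z = CN s"
  proof (rule measure_eqI)
    fix A :: "'b set" assume "A \<in> sets (distr M borel Z)"
    then have [measurable]: "A \<in> sets borel" by simp
    have "emeasure (distr M borel Z) A = emeasure (distr M (borel \<Otimes>\<^sub>M borel) (\<lambda>\<omega>. (e \<omega>, Z \<omega>))) (UNIV \<times> A)"
      by (auto simp: emeasure_distr intro!: arg_cong[where f = "emeasure M"])
    also have "\<dots> = emeasure (CN s) A"
      unfolding eq using A.emeasure_space_1 by (simp add: B.emeasure_pair_measure_Times)
    finally show "emeasure (distr M borel Z) A = emeasure (CN s) A" .
  qed simp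
  show "indep_pair M borel e borel Z" by (simp add: indep_pair_def 1 2 eq)
qed

text \<open>For each fixed value of the other columns the exceptional set is null for column
  \<open>i\<close>; by independence the pair has a product law, and Fubini makes the set of
  exceptional pairs null.\<close>

lemma AE_column_notin_range:
  fixes Z :: "'a \<Rightarrow> complex^'t^'n"
  assumes [measurable]: "Z \<in> borel_measurable M"
    and ind: "indep_pair M borel (\<lambda>\<omega>. column i (Z \<omega>)) borel (\<lambda>\<omega>. replace_column i 0 (Z \<omega>))"
    and dist: "distr M borel (\<lambda>\<omega>. column i (Z \<omega>)) = CN v" and v: "0 < v"
    and card: "CARD('t) + 1 \<le> CARD('n)"
  shows "AE \<omega> in M. column i (Z \<omega>) \<notin> range ((*v) (replace_column i 0 (Z \<omega>)))"
proof -
  define \<nu> where "\<nu> = distr M borel (\<lambda>\<omega>. replace_column i 0 (Z \<omega>))"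
  interpret CN: prob_space "CN v :: (complex^'n) measure" by (rule prob_space_CN)
  interpret \<nu>: prob_space \<nu> unfolding \<nu>_def by (rule prob_space_distr) measurable
  interpret Q: pair_sigma_finite "CN v :: (complex^'n) measure" \<nu> ..
  have [simp, measurable_cong]: "sets \<nu> = sets borel" and [simp]: "space \<nu> = UNIV" by (simp_all add: \<nu>_def)
  have eq: "distr M (borel \<Otimes>\<^sub>M borel) (\<lambda>\<omega>. (column i (Z \<omega>), replace_column i 0 (Z \<omega>))) = CN v \<Otimes>\<^sub>M \<nu>"
    using ind unfolding indep_pair_def \<nu>_def dist by simp
  have "AE x in CN v. x \<notin> range ((*v) (replace_column i 0 R))" for R :: "complex^'t^'n"
    by (rule AE_CN_notin_range_replace_column[OF v card])
  then have "AE R in \<nu>. AE x in CN v. x \<notin> range ((*v) (replace_column i 0 R))" by simp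
  then have "AE p in CN v \<Otimes>\<^sub>M \<nu>. fst p \<notin> range ((*v) (replace_column i 0 (snd p)))"
    by (subst Q.AE_pair_iff[symmetric, where P = "\<lambda>x R. x \<notin> range ((*v) (replace_column i 0 R))"], measurable)
      (subst Q.AE_commute, measurable)
  then show ?thesis unfolding eq[symmetric] by (subst (asm) AE_distr_iff) auto
qed

text \<open>Given the other columns, the squared norm is the inverse of a Gaussian quadratic form in
  column \<open>i\<close>. The assumptions range over all columns because full rank involves each of
  them.\<close>

lemma nn_integral_norm_zf_direction:
  fixes Z :: "'a \<Rightarrow> complex^'t^'n"
  assumes [measurable]: "Z \<in> borel_measurable M"
    and ind: "\<And>k. indep_pair M borel (\<lambda>\<omega>. column k (Z \<omega>)) borel (\<lambda>\<omega>. replace_column k 0 (Z \<omega>))"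
    and dist: "\<And>k. distr M borel (\<lambda>\<omega>. column k (Z \<omega>)) = CN (v k)" and v: "\<And>k. 0 < v k"
    and card: "CARD('t) + 1 \<le> CARD('n)"
  shows "(\<integral>\<^sup>+\<omega>. ennreal ((norm (zf_direction (Z \<omega>) i))\<^sup>2) \<partial>M) =
         ennreal (1 / (v i * (real CARD('n) - real CARD('t))))"
proof -
  define \<nu> where "\<nu> = distr M borel (\<lambda>\<omega>. replace_column i 0 (Z \<omega>))"
  interpret CN: prob_space "CN (v i) :: (complex^'n) measure" by (rule prob_space_CN)
  interpret \<nu>: prob_space \<nu> unfolding \<nu>_def by (rule prob_space_distr) measurable
  interpret Q: pair_sigma_finite "CN (v i) :: (complex^'n) measure" \<nu> ..
  have [simp, measurable_cong]: "sets \<nu> = sets borel" and [simp]: "space \<nu> = UNIV" by (simp_all add: \<nu>_def)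
  have eq: "distr M (borel \<Otimes>\<^sub>M borel) (\<lambda>\<omega>. (column i (Z \<omega>), replace_column i 0 (Z \<omega>))) = CN (v i) \<Otimes>\<^sub>M \<nu>"
    using ind[of i] unfolding indep_pair_def \<nu>_def dist by simp
  define h where "h = (\<lambda>(x, R :: complex^'t^'n). ennreal ((norm (zf_direction (replace_column i x R) i))\<^sup>2))"
  have [measurable]: "h \<in> borel_measurable (borel \<Otimes>\<^sub>M borel)" unfolding h_def by measurable
  have "(\<integral>\<^sup>+\<omega>. ennreal ((norm (zf_direction (Z \<omega>) i))\<^sup>2) \<partial>M) =
      (\<integral>\<^sup>+\<omega>. h (column i (Z \<omega>), replace_column i 0 (Z \<omega>)) \<partial>M)"
    by (simp add: h_def)
  also have "\<dots> = (\<integral>\<^sup>+p. h p \<partial>(CN (v i) \<Otimes>\<^sub>M \<nu>))"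
    unfolding eq[symmetric] by (simp add: nn_integral_distr)
  also have "\<dots> = (\<integral>\<^sup>+R. \<integral>\<^sup>+x. h (x, R) \<partial>CN (v i) \<partial>\<nu>)"
    by (rule Q.nn_integral_snd[symmetric]) measurable
  \<comment> \<open>The outer integral returns to \<open>M\<close>: full rank is known for almost
    every \<open>Z \<omega>\<close>, while \<open>x\<close> is integrated as a fresh copy of column
    \<open>i\<close>.\<close>
  also have "\<dots> = (\<integral>\<^sup>+\<omega>. \<integral>\<^sup>+x. h (x, replace_column i 0 (Z \<omega>)) \<partial>CN (v i) \<partial>M)"
    unfolding \<nu>_def by (subst nn_integral_distr) auto
  also have "\<dots> = (\<integral>\<^sup>+\<omega>. ennreal (1 / (v i * (real CARD('n) - real CARD('t)))) \<partial>M)"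
  proof (rule nn_integral_cong_AE)
    have "AE \<omega> in M. \<forall>k. column k (Z \<omega>) \<notin> range ((*v) (replace_column k 0 (Z \<omega>)))"
      by (subst AE_all_countable) (intro allI AE_column_notin_range[OF assms(1) ind dist v card])
    then show "AE \<omega> in M. (\<integral>\<^sup>+x. h (x, replace_column i 0 (Z \<omega>)) \<partial>CN (v i)) =
        ennreal (1 / (v i * (real CARD('n) - real CARD('t))))"
    proof eventually_elim
      fix \<omega> assume "\<forall>k. column k (Z \<omega>) \<notin> range ((*v) (replace_column k 0 (Z \<omega>)))"
      then have inj: "x = 0" if "Z \<omega> *v x = 0" for x
        using independent_columns[of "Z \<omega>" x] that by blast
      obtain S :: "(complex^'n) set" where S: "pairwise orthogonal S" "\<And>s. s \<in> S \<Longrightarrow> norm s = 1"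
        "card S + 2 * (CARD('t) - 1) = 2 * CARD('n)"
        and zf: "\<And>x. x \<notin> range ((*v) (replace_column i 0 (Z \<omega>))) \<Longrightarrow>
          ennreal ((norm (zf_direction (replace_column i x (Z \<omega>)) i))\<^sup>2) = inverse (ennreal (\<Sum>s\<in>S. (x \<bullet> s)\<^sup>2))"
        using norm_zf_direction_replace_column[of "Z \<omega>" i, OF inj] by blast
      have "0 < CARD('t)" by simp
      \<comment> \<open>The complex dimension is \<open>CARD('n) - (CARD('t) - 1)\<close>, at least
        2 by \<open>card\<close>; the moment formula lowers it by one to
        \<open>CARD('n) - CARD('t)\<close>.\<close>
      then have m: "card S = 2 * (CARD('n) + 1 - CARD('t))" "2 \<le> CARD('n) + 1 - CARD('t)"
        using S(3) card by linarith+
      have "(\<integral>\<^sup>+x. h (x, replace_column i 0 (Z \<omega>)) \<partial>CN (v i)) =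
          (\<integral>\<^sup>+x. inverse (ennreal (\<Sum>s\<in>S. (x \<bullet> s)\<^sup>2)) \<partial>CN (v i))"
        using AE_CN_notin_range_replace_column[where R = "Z \<omega>" and i = i, OF v card, of i]
        by (intro nn_integral_cong_AE, eventually_elim) (simp add: h_def zf)
      also have "\<dots> = ennreal (1 / (v i * (real (CARD('n) + 1 - CARD('t)) - 1)))"
        by (rule nn_integral_CN_inverse_orthonormal[OF S(1) _ m v]) (rule S(2))
      also have "real (CARD('n) + 1 - CARD('t)) - 1 = real CARD('n) - real CARD('t)"
        using card by simp
      finally show "(\<integral>\<^sup>+x. h (x, replace_column i 0 (Z \<omega>)) \<partial>CN (v i)) =
        ennreal (1 / (v i * (real CARD('n) - real CARD('t))))" .
    qed
  qed
  also have "\<dots> = ennreal (1 / (v i * (real CARD('n) - real CARD('t))))"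
    by (simp add: emeasure_space_1)
  finally show ?thesis .
qed

text \<open>For fixed \<open>y\<close> the projection on \<open>y\<close> consists of two real
  coordinates, each of mean square \<open>v / 2 * (norm y)\<^sup>2\<close>; independence allows
  integrating over \<open>X\<close> with \<open>u\<close> held fixed.\<close>

lemma nn_integral_cinner_indep:
  fixes X u :: "'a \<Rightarrow> complex^'n"
  assumes ind: "indep_pair M borel X borel u" and dist: "distr M borel X = CN v" and v: "0 \<le> v"
  shows "(\<integral>\<^sup>+\<omega>. ennreal ((cmod (cinner (X \<omega>) (u \<omega>)))\<^sup>2) \<partial>M) =
    ennreal v * (\<integral>\<^sup>+\<omega>. ennreal ((norm (u \<omega>))\<^sup>2) \<partial>M)"
proof -
  have [measurable]: "X \<in> borel_measurable M" "u \<in> borel_measurable M"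
    using ind by (auto simp: indep_pair_def)
  define \<nu> where "\<nu> = distr M borel u"
  interpret CN: prob_space "CN v :: (complex^'n) measure" by (rule prob_space_CN)
  interpret \<nu>: prob_space \<nu> unfolding \<nu>_def by (rule prob_space_distr) measurable
  interpret Q: pair_sigma_finite "CN v :: (complex^'n) measure" \<nu> ..
  have [simp, measurable_cong]: "sets \<nu> = sets borel" and [simp]: "space \<nu> = UNIV" by (simp_all add: \<nu>_def)
  have eq: "distr M (borel \<Otimes>\<^sub>M borel) (\<lambda>\<omega>. (X \<omega>, u \<omega>)) = CN v \<Otimes>\<^sub>M \<nu>"
    using ind unfolding indep_pair_def \<nu>_def dist by simp
  have inner: "(\<integral>\<^sup>+x. ennreal ((cmod (cinner x y))\<^sup>2) \<partial>CN v) = ennreal v * ennreal ((norm y)\<^sup>2)" for y :: "complex^'n"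
  proof -
    have "(\<integral>\<^sup>+x. ennreal ((cmod (cinner x y))\<^sup>2) \<partial>CN v) =
        (\<integral>\<^sup>+x. ennreal ((x \<bullet> y)\<^sup>2) \<partial>CN v) + (\<integral>\<^sup>+x. ennreal ((x \<bullet> (\<i> *s y))\<^sup>2) \<partial>CN v)"
      by (subst nn_integral_add[symmetric]) (auto simp: cmod_cinner_square)
    also have "\<dots> = ennreal (v / 2 * (norm y)\<^sup>2 + v / 2 * (norm y)\<^sup>2)"
      using v by (simp add: nn_integral_CN_inner_square norm_scale_i flip: ennreal_plus)
    also have "\<dots> = ennreal v * ennreal ((norm y)\<^sup>2)"
      using v by (simp flip: ennreal_mult)
    finally show ?thesis .
  qed
  have "(\<integral>\<^sup>+\<omega>. ennreal ((cmod (cinner (X \<omega>) (u \<omega>)))\<^sup>2) \<partial>M) =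
      (\<integral>\<^sup>+p. ennreal ((cmod (cinner (fst p) (snd p)))\<^sup>2) \<partial>(CN v \<Otimes>\<^sub>M \<nu>))"
    unfolding eq[symmetric] by (simp add: nn_integral_distr)
  also have "\<dots> = (\<integral>\<^sup>+y. \<integral>\<^sup>+x. ennreal ((cmod (cinner (fst (x, y)) (snd (x, y))))\<^sup>2) \<partial>CN v \<partial>\<nu>)"
    by (rule Q.nn_integral_snd[symmetric]) measurable
  also have "\<dots> = (\<integral>\<^sup>+y. ennreal v * ennreal ((norm y)\<^sup>2) \<partial>\<nu>)" by (simp add: inner)
  also have "\<dots> = ennreal v * (\<integral>\<^sup>+\<omega>. ennreal ((norm (u \<omega>))\<^sup>2) \<partial>M)"
    unfolding \<nu>_def by (simp add: nn_integral_cmult nn_integral_distr)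
  finally show ?thesis .
qed

text \<open>By symmetry \<open>(- X, u)\<close> has the same joint law as \<open>(X, u)\<close>, so
  the integral equals its own negative.\<close>

lemma integral_cinner_indep:
  fixes X u :: "'a \<Rightarrow> complex^'n"
  assumes ind: "indep_pair M borel X borel u" and dist: "distr M borel X = CN v"
  shows "(\<integral>\<omega>. cinner (X \<omega>) (u \<omega>) \<partial>M) = 0"
proof -
  have [measurable]: "X \<in> borel_measurable M" "u \<in> borel_measurable M"
    using ind by (auto simp: indep_pair_def)
  have ind': "indep_pair M borel (\<lambda>\<omega>. - X \<omega>) borel u"
    by (rule indep_pair_compose[OF ind, of uminus borel "\<lambda>x. x" borel]) auto
  have "orthogonal_transformation (uminus :: complex^'n \<Rightarrow> _)"
    by (simp add: orthogonal_transformation linear_iff)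
  then have "distr (CN v) borel uminus = (CN v :: (complex^'n) measure)" by (rule distr_CN_orthogonal)
  then have "distr M borel (\<lambda>\<omega>. - X \<omega>) = CN v"
    by (simp flip: dist add: distr_distr o_def)
  then have "distr M (borel \<Otimes>\<^sub>M borel) (\<lambda>\<omega>. (X \<omega>, u \<omega>)) = distr M (borel \<Otimes>\<^sub>M borel) (\<lambda>\<omega>. (- X \<omega>, u \<omega>))"
    using ind ind' by (simp add: indep_pair_def dist)
  then have "(\<integral>p. cinner (fst p) (snd p) \<partial>distr M (borel \<Otimes>\<^sub>M borel) (\<lambda>\<omega>. (X \<omega>, u \<omega>))) =
      (\<integral>p. cinner (fst p) (snd p) \<partial>distr M (borel \<Otimes>\<^sub>M borel) (\<lambda>\<omega>. (- X \<omega>, u \<omega>)))" by simp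
  then have "(\<integral>\<omega>. cinner (X \<omega>) (u \<omega>) \<partial>M) = (\<integral>\<omega>. cinner (- X \<omega>) (u \<omega>) \<partial>M)"
    by (simp add: integral_distr)
  then show ?thesis by (simp add: cinner_minus_left)
qed

end

section \<open>The pilot model\<close>

lemma (in prob_space) indep_set_disjoint_generators:
  assumes ind: "indep_sets E I" and AB: "A \<subseteq> I" "B \<subseteq> I" "A \<inter> B = {}"
    and stable: "\<And>s. Int_stable (E s)"
  shows "indep_set (sigma_sets (space M) (\<Union>s\<in>A. E s)) (sigma_sets (space M) (\<Union>s\<in>B. E s))"
proof -
  \<comment> \<open>The two groups are indexed by \<open>bool\<close>, the form in which
    \<open>indep_set\<close> is defined.\<close>
  have "indep_sets (\<lambda>j. sigma_sets (space M) (\<Union>i\<in>case_bool A B j. E i)) UNIV"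
  proof (rule indep_sets_collect_sigma)
    show "indep_sets E (\<Union>j\<in>UNIV. case_bool A B j)"
      using AB by (intro indep_sets_mono_index[OF _ ind]) (auto split: bool.splits)
    show "disjoint_family_on (case_bool A B) UNIV"
      using AB(3) by (auto simp: disjoint_family_on_def split: bool.splits)
  qed (rule stable)
  moreover have "(\<lambda>j. sigma_sets (space M) (\<Union>i\<in>case_bool A B j. E i)) =
      case_bool (sigma_sets (space M) (\<Union>s\<in>A. E s)) (sigma_sets (space M) (\<Union>s\<in>B. E s))"
    by (auto simp: fun_eq_iff split: bool.splits)
  ultimately show ?thesis by (simp add: indep_set_def)
qed

lemma Int_stable_generated_events: "Int_stable (generated_events M X)"
proof (rule Int_stableI)
  fix a b assume "a \<in> generated_events M X" "b \<in> generated_events M X"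
  then obtain A B where "a = X -` A \<inter> space M" "A \<in> sets borel" "b = X -` B \<inter> space M" "B \<in> sets borel"
    by (auto simp: generated_events_def)
  then have "a \<inter> b = X -` (A \<inter> B) \<inter> space M" "A \<inter> B \<in> sets borel" by auto
  then show "a \<inter> b \<in> generated_events M X" unfolding generated_events_def by blast
qed

lemma Int_stable_source_events: "Int_stable (source_events M f w g s)"
  by (cases s) (simp_all add: source_events_def Int_stable_generated_events)

lemma source_events_subset: "source_events M f w g s \<subseteq> Pow (space M)"
  by (cases s) (auto simp: source_events_def generated_events_def)

text \<open>Each summand is a measurable function of one column, so measurability of a matrix can be
  checked columnwise.\<close>

lemma matrix_eq_sum_columns: "(Z :: complex^'t^'n) = (\<Sum>k\<in>UNIV. replace_column k (column k Z) 0)"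
proof -
  have "Z $ r $ c = (\<Sum>k\<in>UNIV. replace_column k (column k Z) 0) $ r $ c" for r c
  proof -
    have "(\<Sum>k\<in>UNIV. replace_column k (column k Z) 0) $ r $ c = (\<Sum>k\<in>UNIV. if k = c then Z $ r $ c else 0)"
      unfolding sum_component by (intro sum.cong) (auto simp: replace_column_def column_def)
    then show ?thesis by simp
  qed
  then show ?thesis by (simp add: vec_eq_iff)
qed

lemma borel_measurable_columns:
  fixes Z :: "'a \<Rightarrow> complex^'t^'n"
  assumes "\<And>k. (\<lambda>\<omega>. column k (Z \<omega>)) \<in> borel_measurable N"
  shows "Z \<in> borel_measurable N"
proof -
  note assms [measurable]
  have "(\<lambda>\<omega>. \<Sum>k\<in>UNIV. replace_column k (column k (Z \<omega>)) 0) \<in> borel_measurable N" by measurable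
  then show ?thesis by (simp flip: matrix_eq_sum_columns)
qed

locale pilot_model = prob_space M for M :: "'w measure" +
  fixes Ad :: "'a set" and Uu Ud :: "'u set"
    and f :: "'a \<Rightarrow> 'u \<Rightarrow> 'w \<Rightarrow> complex^'n::finite"
    and w :: "'a \<Rightarrow> 't::finite \<Rightarrow> 'w \<Rightarrow> complex^'n"
    and g :: "'u \<Rightarrow> 'u \<Rightarrow> 'w \<Rightarrow> complex"
    and \<beta> :: "'a \<Rightarrow> 'u \<Rightarrow> real" and l :: "'u \<Rightarrow> 't" and Ep :: "'u \<Rightarrow> real" and N0 :: real
  assumes finite_users: "finite Uu" "finite Ud"
    and \<beta>_pos: "\<And>j k. j \<in> Ad \<Longrightarrow> k \<in> Uu \<union> Ud \<Longrightarrow> \<beta> j k > 0"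
    and Ep_pos: "\<And>k. k \<in> Uu \<union> Ud \<Longrightarrow> Ep k > 0"
    and N0_pos: "N0 > 0"
    and CN_f: "\<And>j k. j \<in> Ad \<Longrightarrow> k \<in> Uu \<union> Ud \<Longrightarrow> has_CN M (f j k) (\<beta> j k)"
    and CN_w: "\<And>j i. j \<in> Ad \<Longrightarrow> has_CN M (w j i) N0"
    and indep_sources: "indep_sets (source_events M f w g) (sources Ad Uu Ud)"
    and more_antennas: "CARD('t) + 1 \<le> CARD('n)"
begin

abbreviation "U \<equiv> Uu \<union> Ud"
abbreviation "Z \<equiv> despread_matrix U l Ep f w"

text \<open>Every random quantity is placed in \<open>gen A\<close> for the set \<open>A\<close> of
  sources it is built from; independence then follows from disjointness of these sets, whatever the
  value types.\<close>

definition gen :: "('a, 'u, 't) source set \<Rightarrow> 'w measure" where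
  "gen A = sigma (space M) (\<Union>s\<in>A. source_events M f w g s)"

lemma space_gen [simp]: "space (gen A) = space M"
  unfolding gen_def by (intro space_measure_of UN_least source_events_subset)

lemma sets_gen: "sets (gen A) = sigma_sets (space M) (\<Union>s\<in>A. source_events M f w g s)"
  unfolding gen_def by (intro sets_measure_of UN_least source_events_subset)

lemma sets_gen_mono: "A \<subseteq> B \<Longrightarrow> sets (gen A) \<subseteq> sets (gen B)"
  unfolding sets_gen by (rule sigma_sets_mono') blast

lemma measurable_gen_mono: "X \<in> gen A \<rightarrow>\<^sub>M S \<Longrightarrow> A \<subseteq> B \<Longrightarrow> X \<in> gen B \<rightarrow>\<^sub>M S"
  using sets_gen_mono[of A B] by (auto simp: measurable_def)

lemma measurable_gen_imp: "X \<in> gen A \<rightarrow>\<^sub>M S \<Longrightarrow> A \<subseteq> sources Ad Uu Ud \<Longrightarrow> X \<in> M \<rightarrow>\<^sub>M S"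
proof -
  assume X: "X \<in> gen A \<rightarrow>\<^sub>M S" and A: "A \<subseteq> sources Ad Uu Ud"
  have "(\<Union>s\<in>A. source_events M f w g s) \<subseteq> events"
    using indep_sources A unfolding indep_sets_def by blast
  then have "sets (gen A) \<subseteq> events" unfolding sets_gen by (rule sets.sigma_sets_subset)
  then show ?thesis using X unfolding measurable_def by auto
qed

lemma indep_pair_gen:
  assumes X: "X \<in> gen A \<rightarrow>\<^sub>M S" and Y: "Y \<in> gen B \<rightarrow>\<^sub>M T"
    and AB: "A \<subseteq> sources Ad Uu Ud" "B \<subseteq> sources Ad Uu Ud" "A \<inter> B = {}"
  shows "indep_pair M S X T Y"
proof (rule indep_pairI_indep_set)
  show "indep_set (sets (gen A)) (sets (gen B))"
    unfolding sets_gen by (rule indep_set_disjoint_generators[OF indep_sources AB Int_stable_source_events])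
  show "X -` A' \<inter> space M \<in> sets (gen A)" if "A' \<in> sets S" for A'
    using measurable_sets[OF X that] by simp
  show "Y -` B' \<inter> space M \<in> sets (gen B)" if "B' \<in> sets T" for B'
    using measurable_sets[OF Y that] by simp
qed (use measurable_gen_imp X Y AB in auto)

lemma measurable_gen_source:
  fixes X :: "'w \<Rightarrow> 'b::topological_space"
  assumes "s \<in> A" and "source_events M f w g s = generated_events M X"
  shows "X \<in> borel_measurable (gen A)"
proof (rule measurableI)
  fix B :: "'b set" assume B: "B \<in> sets borel"
  have "X -` B \<inter> space M \<in> source_events M f w g s"
    unfolding assms(2) generated_events_def using B by blast
  then show "X -` B \<inter> space (gen A) \<in> sets (gen A)"
    using assms(1) by (auto simp: sets_gen)
qed simp

lemma measurable_gen_f: "AP_UE j k \<in> A \<Longrightarrow> f j k \<in> borel_measurable (gen A)"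
  by (erule measurable_gen_source) (simp add: source_events_def)

lemma measurable_gen_w: "Pilot_Noise j i \<in> A \<Longrightarrow> w j i \<in> borel_measurable (gen A)"
  by (erule measurable_gen_source) (simp add: source_events_def)

definition pilot_sources :: "'a \<Rightarrow> 'u set \<Rightarrow> 't \<Rightarrow> ('a, 'u, 't) source set" where
  "pilot_sources j F i = AP_UE j ` F \<union> {Pilot_Noise j i}"

lemma pilot_sources_subset:
  assumes "j \<in> Ad" "F \<subseteq> U" shows "pilot_sources j F i \<subseteq> sources Ad Uu Ud"
  using assms by (auto simp: pilot_sources_def sources_def)

text \<open>The set \<open>F\<close> is left free: the full pilot group gives a column of
  \<open>Z\<close>, the group without one user gives the part independent of that user's channel,
  and the law is found by adding users one at a time.\<close>

definition pilot_sum :: "'a \<Rightarrow> 'u set \<Rightarrow> 't \<Rightarrow> 'w \<Rightarrow> complex^'n" where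
  "pilot_sum j F i \<omega> = (\<Sum>k\<in>F. sqrt (real CARD('t) * Ep k) *\<^sub>R f j k \<omega>) + w j i \<omega>"

lemma column_Z: "column i (Z j \<omega>) = pilot_sum j (pilot_group U l i) i \<omega>"
  by (simp add: column_def despread_matrix_def pilot_sum_def vec_eq_iff)

lemma measurable_gen_pilot_sum:
  assumes "pilot_sources j F i \<subseteq> A"
  shows "pilot_sum j F i \<in> borel_measurable (gen A)"
proof -
  have [measurable]: "w j i \<in> borel_measurable (gen A)"
    using assms by (intro measurable_gen_w) (auto simp: pilot_sources_def)
  have [measurable]: "f j k \<in> borel_measurable (gen A)" if "k \<in> F" for k
    using assms that by (intro measurable_gen_f) (auto simp: pilot_sources_def)
  show ?thesis unfolding pilot_sum_def by measurable
qed

text \<open>For the full pilot group of a user this is the inverse of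
  \<open>c_coeff\<close>.\<close>

definition pilot_var :: "'a \<Rightarrow> 'u set \<Rightarrow> real" where
  "pilot_var j F = real CARD('t) * (\<Sum>k\<in>F. Ep k * \<beta> j k) + N0"

lemma pilot_var_pos:
  assumes "j \<in> Ad" "F \<subseteq> U" shows "0 < pilot_var j F"
proof -
  have "0 \<le> (\<Sum>k\<in>F. Ep k * \<beta> j k)"
    using assms \<beta>_pos Ep_pos by (intro sum_nonneg mult_nonneg_nonneg less_imp_le) auto
  then show ?thesis using N0_pos by (simp add: pilot_var_def add_nonneg_pos)
qed

text \<open>Adding user \<open>k\<close> is one regression of \<open>f j k\<close> on the enlarged
  sum. The third conclusion drives the induction for the law of a column; the first two, with
  \<open>F\<close> the rest of the pilot group, describe the estimation error.\<close>

lemma pilot_regression: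
  assumes j: "j \<in> Ad" and F: "F \<subseteq> U" and k: "k \<in> U" "k \<notin> F"
    and dist: "distr M borel (pilot_sum j F i) = CN (pilot_var j F)"
  defines "b \<equiv> sqrt (real CARD('t) * Ep k)"
  defines "s \<equiv> pilot_var j (insert k F)"
  defines "e \<equiv> \<lambda>\<omega>. f j k \<omega> - (b * \<beta> j k / s) *\<^sub>R pilot_sum j (insert k F) i \<omega>"
  shows "indep_pair M borel e borel (pilot_sum j (insert k F) i)"
    and "distr M borel e = CN (\<beta> j k * pilot_var j F / s)"
    and "distr M borel (pilot_sum j (insert k F) i) = CN s"
proof -
  have fin: "finite F" using F finite_users finite_subset by auto
  have eq: "pilot_sum j (insert k F) i = (\<lambda>\<omega>. b *\<^sub>R f j k \<omega> + pilot_sum j F i \<omega>)"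
    using fin k by (simp add: pilot_sum_def b_def fun_eq_iff add.assoc)
  have ind: "indep_pair M borel (f j k) borel (pilot_sum j F i)"
  proof (rule indep_pair_gen)
    show "f j k \<in> borel_measurable (gen {AP_UE j k})" by (rule measurable_gen_f) simp
    show "pilot_sum j F i \<in> borel_measurable (gen (pilot_sources j F i))"
      by (rule measurable_gen_pilot_sum) simp
    show "{AP_UE j k} \<subseteq> sources Ad Uu Ud" using j k by (auto simp: sources_def)
    show "pilot_sources j F i \<subseteq> sources Ad Uu Ud" by (rule pilot_sources_subset[OF j F])
    show "{AP_UE j k} \<inter> pilot_sources j F i = {}" using k by (auto simp: pilot_sources_def)
  qed
  have X: "distr M borel (f j k) = CN (\<beta> j k)" using CN_f[OF j k(1)] by (simp add: has_CN_def)
  have b2: "b\<^sup>2 = real CARD('t) * Ep k" using Ep_pos[OF k(1)] by (simp add: b_def)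
  have s: "s = b\<^sup>2 * \<beta> j k + pilot_var j F"
    using fin k by (simp add: s_def pilot_var_def b2 algebra_simps)
  have "0 < s" unfolding s_def using F k by (intro pilot_var_pos[OF j]) auto
  note reg = indep_pair_CN_regression[OF ind X dist _ _ s this, folded eq]
  have nn: "0 \<le> \<beta> j k" "0 \<le> pilot_var j F"
    using \<beta>_pos[OF j k(1)] pilot_var_pos[OF j F] by auto
  show "indep_pair M borel e borel (pilot_sum j (insert k F) i)"
    and "distr M borel e = CN (\<beta> j k * pilot_var j F / s)"
    and "distr M borel (pilot_sum j (insert k F) i) = CN s"
    using reg[OF nn] unfolding e_def eq by simp_all
qed

lemma distr_pilot_sum:
  assumes j: "j \<in> Ad" and F: "F \<subseteq> U"
  shows "distr M borel (pilot_sum j F i) = CN (pilot_var j F)"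
proof -
  have "finite F" using F finite_users finite_subset by auto
  then show ?thesis using F
  proof (induction F)
    case empty
    have "pilot_sum j {} i = w j i" by (simp add: pilot_sum_def fun_eq_iff)
    then show ?case using CN_w[OF j, of i] by (simp add: pilot_var_def has_CN_def)
  next
    case (insert k F)
    then show ?case using pilot_regression(3)[OF j, of F k i] by simp
  qed
qed

definition AP_sources :: "'a \<Rightarrow> ('a, 'u, 't) source set" where
  "AP_sources j = (\<Union>i. pilot_sources j (pilot_group U l i) i)"

lemma AP_sources_subset: "j \<in> Ad \<Longrightarrow> AP_sources j \<subseteq> sources Ad Uu Ud"
  unfolding AP_sources_def by (intro UN_least pilot_sources_subset) (auto simp: pilot_group_def)

text \<open>Each of these sources carries its AP, which makes anything computed from them at one AP
  independent of the same at another.\<close>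

lemma AP_sources_disjoint: "j \<noteq> j' \<Longrightarrow> AP_sources j \<inter> AP_sources j' = {}"
  by (auto simp: AP_sources_def pilot_sources_def)

lemma measurable_gen_column:
  assumes "pilot_sources j (pilot_group U l i) i \<subseteq> A"
  shows "(\<lambda>\<omega>. column i (Z j \<omega>)) \<in> borel_measurable (gen A)"
  unfolding column_Z by (rule measurable_gen_pilot_sum[OF assms])

lemma measurable_gen_Z: "Z j \<in> borel_measurable (gen (AP_sources j))"
  by (intro borel_measurable_columns measurable_gen_column) (auto simp: AP_sources_def)

lemma measurable_gen_replace_column_Z:
  "(\<lambda>\<omega>. replace_column i 0 (Z j \<omega>)) \<in> borel_measurable (gen (\<Union>k\<in>-{i}. pilot_sources j (pilot_group U l k) k))"
proof (rule borel_measurable_columns)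
  show "(\<lambda>\<omega>. column k (replace_column i 0 (Z j \<omega>))) \<in> borel_measurable (gen (\<Union>k\<in>-{i}. pilot_sources j (pilot_group U l k) k))" for k
    by (cases "k = i") (auto simp: column_replace_column intro!: measurable_gen_column)
qed

lemma pilot_sources_other_subset:
  "j \<in> Ad \<Longrightarrow> (\<Union>k\<in>-{i}. pilot_sources j (pilot_group U l k) k) \<subseteq> sources Ad Uu Ud"
  using AP_sources_subset[of j] by (auto simp: AP_sources_def)

text \<open>A user belongs to one pilot group only, and every pilot has its own noise.\<close>

lemma pilot_sources_other_disjoint:
  "pilot_sources j (pilot_group U l i) i \<inter> (\<Union>k\<in>-{i}. pilot_sources j (pilot_group U l k) k) = {}"
  by (auto simp: pilot_sources_def pilot_group_def)

lemma measurable_Z [measurable]: "j \<in> Ad \<Longrightarrow> Z j \<in> borel_measurable M"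
  using measurable_gen_imp[OF measurable_gen_Z AP_sources_subset] .

lemma pilot_group_subset: "pilot_group U l i \<subseteq> U"
  by (auto simp: pilot_group_def)

lemma indep_column_Z:
  assumes j: "j \<in> Ad"
  shows "indep_pair M borel (\<lambda>\<omega>. column i (Z j \<omega>)) borel (\<lambda>\<omega>. replace_column i 0 (Z j \<omega>))"
  by (rule indep_pair_gen[OF measurable_gen_column[OF order_refl] measurable_gen_replace_column_Z
    pilot_sources_subset[OF j pilot_group_subset] pilot_sources_other_subset[OF j] pilot_sources_other_disjoint])

lemma distr_column_Z:
  assumes j: "j \<in> Ad"
  shows "distr M borel (\<lambda>\<omega>. column i (Z j \<omega>)) = CN (pilot_var j (pilot_group U l i))"
  unfolding column_Z by (rule distr_pilot_sum[OF j pilot_group_subset])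

text \<open>This is the error of the MMSE estimate: the subtracted term is the regression of
  \<open>f j k\<close> on the column of its pilot.\<close>

definition estimation_error :: "'a \<Rightarrow> 'u \<Rightarrow> 'w \<Rightarrow> complex^'n" where
  "estimation_error j k \<omega> = f j k \<omega> -
     (sqrt (real CARD('t) * Ep k) * \<beta> j k / pilot_var j (pilot_group U l (l k))) *\<^sub>R column (l k) (Z j \<omega>)"

lemma insert_pilot_group: "k \<in> U \<Longrightarrow> insert k (pilot_group U l (l k) - {k}) = pilot_group U l (l k)"
  by (auto simp: pilot_group_def)

text \<open>The small source set matters: only the pilot of \<open>k\<close> is involved, which
  separates the error from the other columns.\<close>

lemma measurable_gen_estimation_error_aux:
  assumes "k \<in> U"
  shows "estimation_error j k \<in> borel_measurable (gen (pilot_sources j (pilot_group U l (l k)) (l k)))"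
proof -
  have [measurable]: "f j k \<in> borel_measurable (gen (pilot_sources j (pilot_group U l (l k)) (l k)))"
    using assms by (intro measurable_gen_f) (auto simp: pilot_sources_def pilot_group_def)
  have [measurable]: "(\<lambda>\<omega>. column (l k) (Z j \<omega>)) \<in> borel_measurable (gen (pilot_sources j (pilot_group U l (l k)) (l k)))"
    by (rule measurable_gen_column) simp
  show ?thesis unfolding estimation_error_def by measurable
qed

lemma measurable_gen_estimation_error:
  assumes "k \<in> U"
  shows "estimation_error j k \<in> borel_measurable (gen (AP_sources j))"
  by (rule measurable_gen_mono[OF measurable_gen_estimation_error_aux[OF assms]]) (auto simp: AP_sources_def)

lemma alpha_square:
  assumes j: "j \<in> Ad" and k: "k \<in> U"
  shows "(alpha_coeff U l Ep \<beta> N0 j k)\<^sup>2 =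
    real CARD('t) * Ep k * (\<beta> j k)\<^sup>2 / pilot_var j (pilot_group U l (l k))"
  using pilot_var_pos[OF j pilot_group_subset, of "l k"] Ep_pos[OF k]
  by (simp add: alpha_coeff_def c_coeff_def power_mult_distrib flip: pilot_var_def) (simp add: field_simps)

text \<open>With \<open>s\<close> the variance of the column, the rest of the group has variance
  \<open>s - CARD('t) * Ep k * \<beta> j k\<close>; multiplying by \<open>\<beta> j k / s\<close>
  leaves \<beta> minus the square of \<alpha>.\<close>

lemma estimation_error_variance:
  assumes j: "j \<in> Ad" and k: "k \<in> U"
  shows "\<beta> j k * pilot_var j (pilot_group U l (l k) - {k}) / pilot_var j (pilot_group U l (l k)) =
    \<beta> j k - (alpha_coeff U l Ep \<beta> N0 j k)\<^sup>2"
proof -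
  have "finite (pilot_group U l (l k))" "k \<in> pilot_group U l (l k)"
    using finite_users k by (auto simp: pilot_group_def)
  then have "pilot_var j (pilot_group U l (l k)) =
      pilot_var j (pilot_group U l (l k) - {k}) + real CARD('t) * Ep k * \<beta> j k"
    by (simp add: pilot_var_def sum.remove algebra_simps)
  then show ?thesis
    using pilot_var_pos[OF j pilot_group_subset, of "l k"] unfolding alpha_square[OF j k]
    by (simp add: field_simps power2_eq_square)
qed

lemma estimation_error:
  assumes j: "j \<in> Ad" and k: "k \<in> U"
  shows distr_estimation_error:
      "distr M borel (estimation_error j k) = CN (\<beta> j k - (alpha_coeff U l Ep \<beta> N0 j k)\<^sup>2)"
    and indep_estimation_error: "indep_pair M borel (estimation_error j k) borel (Z j)"
proof -
  let ?i = "l k" and ?F = "pilot_group U l (l k) - {k}"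
  have F: "?F \<subseteq> U" using pilot_group_subset by blast
  have e: "estimation_error j k = (\<lambda>\<omega>. f j k \<omega> - (sqrt (real CARD('t) * Ep k) * \<beta> j k / pilot_var j (insert k ?F)) *\<^sub>R pilot_sum j (insert k ?F) ?i \<omega>)"
    unfolding insert_pilot_group[OF k] estimation_error_def column_Z ..
  have "k \<notin> ?F" by simp
  \<comment> \<open>The column is split into the contribution of \<open>k\<close> and the rest of
    its pilot group.\<close>
  note reg = pilot_regression[OF j F k this distr_pilot_sum[OF j F, of ?i], folded e, unfolded insert_pilot_group[OF k]]
  show "distr M borel (estimation_error j k) = CN (\<beta> j k - (alpha_coeff U l Ep \<beta> N0 j k)\<^sup>2)"
    using reg(2) by (simp only: estimation_error_variance[OF j k])
  have 1: "indep_pair M borel (estimation_error j k) borel (\<lambda>\<omega>. column ?i (Z j \<omega>))"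
    using reg(1) by (simp only: column_Z)
  have "(\<lambda>\<omega>. (estimation_error j k \<omega>, column ?i (Z j \<omega>))) \<in>
      gen (pilot_sources j (pilot_group U l ?i) ?i) \<rightarrow>\<^sub>M borel \<Otimes>\<^sub>M borel"
    by (intro measurable_Pair measurable_gen_estimation_error_aux[OF k] measurable_gen_column order_refl)
  \<comment> \<open>Regression gives independence from the own column only. Error and own column
    depend on one pilot, so together they are independent of the other columns.\<close>
  then have 2: "indep_pair M (borel \<Otimes>\<^sub>M borel) (\<lambda>\<omega>. (estimation_error j k \<omega>, column ?i (Z j \<omega>)))
      borel (\<lambda>\<omega>. replace_column ?i 0 (Z j \<omega>))"
    by (rule indep_pair_gen[OF _ measurable_gen_replace_column_Z
      pilot_sources_subset[OF j pilot_group_subset] pilot_sources_other_subset[OF j] pilot_sources_other_disjoint])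
  \<comment> \<open>\<open>Z j\<close> is recovered measurably from the own column and the
    rest.\<close>
  have m: "(\<lambda>(x, R). replace_column ?i x R) \<in> borel \<Otimes>\<^sub>M borel \<rightarrow>\<^sub>M (borel :: (complex^'t^'n) measure)" by measurable
  show "indep_pair M borel (estimation_error j k) borel (Z j)"
    using indep_pair_compose[OF indep_pair_assoc[OF 1 2], of "\<lambda>x. x", OF _ m] by simp
qed

lemma nn_integral_zf_direction:
  assumes j: "j \<in> Ad"
  shows "(\<integral>\<^sup>+\<omega>. ennreal ((norm (zf_direction (Z j \<omega>) i))\<^sup>2) \<partial>M) =
    ennreal (1 / (pilot_var j (pilot_group U l i) * (real CARD('n) - real CARD('t))))"
  using j
  by (intro nn_integral_norm_zf_direction indep_column_Z distr_column_Z pilot_var_pos pilot_group_subset more_antennas measurable_Z)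

lemma AE_column_zf_direction:
  assumes j: "j \<in> Ad"
  shows "AE \<omega> in M. cinner (column k (Z j \<omega>)) (zf_direction (Z j \<omega>) i) = (if k = i then 1 else 0)"
proof -
  have "AE \<omega> in M. \<forall>k. column k (Z j \<omega>) \<notin> range ((*v) (replace_column k 0 (Z j \<omega>)))"
    using j by (subst AE_all_countable) (intro allI AE_column_notin_range[OF measurable_Z indep_column_Z distr_column_Z]
      pilot_var_pos pilot_group_subset more_antennas)
  then show ?thesis
  proof eventually_elim
    fix \<omega> assume *: "\<forall>k. column k (Z j \<omega>) \<notin> range ((*v) (replace_column k 0 (Z j \<omega>)))"
    have "x = 0" if "Z j \<omega> *v x = 0" for x by (rule independent_columns[OF _ that]) (use * in blast)
    then show "cinner (column k (Z j \<omega>)) (zf_direction (Z j \<omega>) i) = (if k = i then 1 else 0)"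
      by (intro cinner_column_zf_direction invertible_gram)
  qed
qed

end

section \<open>The SINR\<close>

context prob_space begin

lemma integrable_of_square_integrable:
  fixes Y :: "'a \<Rightarrow> complex"
  assumes [measurable]: "Y \<in> borel_measurable M" and sq: "integrable M (\<lambda>\<omega>. (cmod (Y \<omega>))\<^sup>2)"
  shows "integrable M Y"
proof (rule Bochner_Integration.integrable_bound)
  show "integrable M (\<lambda>\<omega>. 1 + (cmod (Y \<omega>))\<^sup>2)" using sq by simp
  have "x \<le> 1 + x\<^sup>2" for x :: real
    using zero_le_power2[of "x - 1 / 2"] by (simp add: power2_eq_square algebra_simps)
  then show "AE \<omega> in M. norm (Y \<omega>) \<le> norm (1 + (cmod (Y \<omega>))\<^sup>2)" by simp
qed simp

text \<open>Expanding the square, cross terms of distinct indices vanish by pairwise independence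
  and zero mean. The constant \<open>m\<close> stays free to cover centred and uncentred moments
  alike.\<close>

lemma second_moment_indep_sum:
  fixes Y :: "'i \<Rightarrow> 'a \<Rightarrow> complex" and \<kappa> :: "'i \<Rightarrow> real"
  assumes fin: "finite J"
    and meas: "\<And>j. j \<in> J \<Longrightarrow> Y j \<in> borel_measurable M"
    and ind: "\<And>i j. i \<in> J \<Longrightarrow> j \<in> J \<Longrightarrow> i \<noteq> j \<Longrightarrow> indep_pair M borel (Y i) borel (Y j)"
    and sq: "\<And>j. j \<in> J \<Longrightarrow> integrable M (\<lambda>\<omega>. (cmod (Y j \<omega>))\<^sup>2)"
    and zero: "\<And>j. j \<in> J \<Longrightarrow> (\<integral>\<omega>. Y j \<omega> \<partial>M) = 0"
  shows "(\<integral>\<omega>. (cmod (m + (\<Sum>j\<in>J. of_real (\<kappa> j) * Y j \<omega>)))\<^sup>2 \<partial>M) =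
    (cmod m)\<^sup>2 + (\<Sum>j\<in>J. (\<kappa> j)\<^sup>2 * (\<integral>\<omega>. (cmod (Y j \<omega>))\<^sup>2 \<partial>M))"
proof -
  have int: "integrable M (Y j)" if "j \<in> J" for j
    using integrable_of_square_integrable[OF meas sq] that by blast
  have prod: "integrable M (\<lambda>\<omega>. Y i \<omega> * cnj (Y j \<omega>)) \<and>
      (\<integral>\<omega>. Y i \<omega> * cnj (Y j \<omega>) \<partial>M) = (if j = i then of_real (\<integral>\<omega>. (cmod (Y i \<omega>))\<^sup>2 \<partial>M) else 0)"
    if "i \<in> J" "j \<in> J" for i j
  proof (cases "i = j")
    case True
    have "(\<lambda>\<omega>. Y i \<omega> * cnj (Y j \<omega>)) = (\<lambda>\<omega>. complex_of_real ((cmod (Y i \<omega>))\<^sup>2))"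
      using True complex_norm_square by metis
    then show ?thesis using True sq[OF that(1)] by (simp del: of_real_power)
  next
    case False
    have "indep_pair M borel (Y i) borel (\<lambda>\<omega>. cnj (Y j \<omega>))"
      by (rule indep_pair_compose[OF ind[OF that False], of "\<lambda>x. x" borel cnj borel])
        (auto intro: borel_measurable_continuous_onI continuous_intros)
    then have iv: "indep_var borel (Y i) borel (\<lambda>\<omega>. cnj (Y j \<omega>))"
      by (simp add: indep_pair_def indep_var_distribution_eq)
    have i: "integrable M (\<lambda>\<omega>. cnj (Y j \<omega>))" using int[OF that(2)] by simp
    show ?thesis
      using indep_var_integrable[OF iv int[OF that(1)] i] indep_var_lebesgue_integral[OF iv int[OF that(1)] i]
        zero[OF that(1)] False by simp
  qed
  define S where "S = (\<lambda>\<omega>. \<Sum>j\<in>J. of_real (\<kappa> j) * Y j \<omega>)"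
  have S: "integrable M S" "(\<integral>\<omega>. S \<omega> \<partial>M) = 0"
    unfolding S_def using int zero by (auto simp: Bochner_Integration.integral_sum)
  have SS_eq: "S \<omega> * cnj (S \<omega>) = (\<Sum>i\<in>J. \<Sum>j\<in>J. of_real (\<kappa> i * \<kappa> j) * (Y i \<omega> * cnj (Y j \<omega>)))" for \<omega>
    by (simp add: S_def sum_product mult_ac)
  have SS: "integrable M (\<lambda>\<omega>. S \<omega> * cnj (S \<omega>))"
    unfolding SS_eq using prod by (intro Bochner_Integration.integrable_sum integrable_mult_right) auto
  have "(\<integral>\<omega>. S \<omega> * cnj (S \<omega>) \<partial>M) = (\<Sum>i\<in>J. \<Sum>j\<in>J. of_real (\<kappa> i * \<kappa> j) * (\<integral>\<omega>. Y i \<omega> * cnj (Y j \<omega>) \<partial>M))"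
    unfolding SS_eq using prod
    by (subst Bochner_Integration.integral_sum, force, intro sum.cong refl,
        subst Bochner_Integration.integral_sum, force, intro sum.cong refl) (simp add: prod)
  also have "\<dots> = (\<Sum>i\<in>J. \<Sum>j\<in>J. if j = i then of_real ((\<kappa> i)\<^sup>2 * (\<integral>\<omega>. (cmod (Y i \<omega>))\<^sup>2 \<partial>M)) else 0)"
    using prod by (intro sum.cong refl) (auto simp: power2_eq_square)
  also have "\<dots> = of_real (\<Sum>i\<in>J. (\<kappa> i)\<^sup>2 * (\<integral>\<omega>. (cmod (Y i \<omega>))\<^sup>2 \<partial>M))"
    using fin by (simp add: sum.delta)
  finally have ESS: "(\<integral>\<omega>. S \<omega> * cnj (S \<omega>) \<partial>M) = of_real (\<Sum>i\<in>J. (\<kappa> i)\<^sup>2 * (\<integral>\<omega>. (cmod (Y i \<omega>))\<^sup>2 \<partial>M))" .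
  have cS: "integrable M (\<lambda>\<omega>. cnj (S \<omega>))" "(\<integral>\<omega>. cnj (S \<omega>) \<partial>M) = 0"
    using S by simp_all
  have eq: "complex_of_real ((cmod (m + S \<omega>))\<^sup>2) = m * cnj m + m * cnj (S \<omega>) + cnj m * S \<omega> + S \<omega> * cnj (S \<omega>)" for \<omega>
    unfolding complex_norm_square by (simp add: algebra_simps)
  have "complex_of_real (\<integral>\<omega>. (cmod (m + S \<omega>))\<^sup>2 \<partial>M) = (\<integral>\<omega>. complex_of_real ((cmod (m + S \<omega>))\<^sup>2) \<partial>M)"
    by (simp only: integral_complex_of_real)
  also have "\<dots> = m * cnj m + of_real (\<Sum>i\<in>J. (\<kappa> i)\<^sup>2 * (\<integral>\<omega>. (cmod (Y i \<omega>))\<^sup>2 \<partial>M))"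
    unfolding eq using S cS SS ESS by (simp add: prob_space)
  also have "\<dots> = of_real ((cmod m)\<^sup>2 + (\<Sum>i\<in>J. (\<kappa> i)\<^sup>2 * (\<integral>\<omega>. (cmod (Y i \<omega>))\<^sup>2 \<partial>M)))"
    by (simp only: complex_norm_square[symmetric] of_real_add)
  finally show ?thesis unfolding S_def of_real_eq_iff .
qed

lemma integral_norm_square_CN_complex:
  assumes "has_CN M X v" and v: "0 \<le> v"
  shows "(\<integral>\<omega>. (cmod (X \<omega>))\<^sup>2 \<partial>M) = v"
proof -
  have [measurable]: "X \<in> borel_measurable M" and X: "distr M borel X = CN v"
    using assms by (auto simp: has_CN_def)
  have "(\<integral>\<^sup>+\<omega>. ennreal ((cmod (X \<omega>))\<^sup>2) \<partial>M) = (\<integral>\<^sup>+x. ennreal ((cmod x)\<^sup>2) \<partial>CN v)"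
    unfolding X[symmetric] by (simp add: nn_integral_distr)
  also have "\<dots> = (\<integral>\<^sup>+x. ennreal ((x \<bullet> (1 :: complex))\<^sup>2) \<partial>CN v) + (\<integral>\<^sup>+x. ennreal ((x \<bullet> \<i>)\<^sup>2) \<partial>CN v)"
    by (subst nn_integral_add[symmetric]) (auto simp: cmod_power2 inner_complex_def)
  also have "\<dots> = ennreal v"
    unfolding nn_integral_CN_inner_square[OF v] using v by (simp flip: ennreal_plus)
  finally show ?thesis using v by (subst integral_eq_nn_integral) auto
qed

end

section \<open>Mean and fluctuation of the effective channel\<close>

context pilot_model begin

abbreviation "\<alpha> \<equiv> alpha_coeff U l Ep \<beta> N0"
abbreviation "p j i \<equiv> zf_precoder M (Z j) i"

lemma card_diff_pos: "0 < (real CARD('n) - real CARD('t))"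
  using more_antennas by linarith

lemma integral_norm_zf_direction:
  assumes j: "j \<in> Ad"
  shows "(\<integral>\<omega>. (norm (zf_direction (Z j \<omega>) i))\<^sup>2 \<partial>M) = 1 / (pilot_var j (pilot_group U l i) * (real CARD('n) - real CARD('t)))"
proof -
  have [measurable]: "Z j \<in> borel_measurable M" by (rule measurable_Z[OF j])
  show ?thesis
    using card_diff_pos pilot_var_pos[OF j pilot_group_subset, of i]
    by (subst integral_eq_nn_integral) (auto simp: nn_integral_zf_direction[OF j])
qed

lemma zf_precoder_eq:
  assumes j: "j \<in> Ad"
  shows "p j i \<omega> = sqrt (pilot_var j (pilot_group U l i) * (real CARD('n) - real CARD('t))) *\<^sub>R zf_direction (Z j \<omega>) i"
  unfolding zf_precoder_def integral_norm_zf_direction[OF j]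
  by (simp add: real_sqrt_divide)

text \<open>Unit mean power is the purpose of the normalisation: it lets the residual inherit the
  variance of the estimation error, for every pilot \<open>i\<close>.\<close>

lemma nn_integral_zf_precoder:
  assumes j: "j \<in> Ad"
  shows "(\<integral>\<^sup>+\<omega>. ennreal ((norm (p j i \<omega>))\<^sup>2) \<partial>M) = 1"
proof -
  have [measurable]: "Z j \<in> borel_measurable M" by (rule measurable_Z[OF j])
  let ?s = "pilot_var j (pilot_group U l i) * (real CARD('n) - real CARD('t))"
  have s: "0 < ?s" using card_diff_pos pilot_var_pos[OF j pilot_group_subset, of i] by simp
  have "(\<integral>\<^sup>+\<omega>. ennreal ((norm (p j i \<omega>))\<^sup>2) \<partial>M) =
      (\<integral>\<^sup>+\<omega>. ennreal ?s * ennreal ((norm (zf_direction (Z j \<omega>) i))\<^sup>2) \<partial>M)"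
    using s unfolding zf_precoder_eq[OF j]
    by (simp add: power_mult_distrib flip: ennreal_mult)
  also have "\<dots> = ennreal ?s * ennreal (1 / ?s)"
    by (subst nn_integral_cmult) (auto simp: nn_integral_zf_direction[OF j])
  also have "\<dots> = 1"
  proof -
    have "ennreal x * ennreal (1 / x) = 1" if "0 < x" for x using that by (simp flip: ennreal_mult)
    then show ?thesis using s by blast
  qed
  finally show ?thesis .
qed

lemma borel_measurable_scaled_zf_direction:
  "(\<lambda>Z :: complex^'t^'n. c *\<^sub>R zf_direction Z i) \<in> borel_measurable borel"
  by measurable

text \<open>The random part of the effective channel. The pilot \<open>i\<close> of the precoder may
  differ from that of \<open>k\<close>, so that desired signal and interference are treated
  alike.\<close>

definition residual :: "'a \<Rightarrow> 'u \<Rightarrow> 't \<Rightarrow> 'w \<Rightarrow> complex" where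
  "residual j k i \<omega> = cinner (estimation_error j k \<omega>) (p j i \<omega>)"

lemma measurable_gen_residual:
  assumes j: "j \<in> Ad" and k: "k \<in> U"
  shows "residual j k i \<in> borel_measurable (gen (AP_sources j))"
proof -
  have [measurable]: "Z j \<in> borel_measurable (gen (AP_sources j))"
    "estimation_error j k \<in> borel_measurable (gen (AP_sources j))"
    by (rule measurable_gen_Z, rule measurable_gen_estimation_error[OF k])
  show ?thesis unfolding residual_def zf_precoder_eq[OF j] by measurable
qed

lemma measurable_residual:
  "j \<in> Ad \<Longrightarrow> k \<in> U \<Longrightarrow> residual j k i \<in> borel_measurable M"
  using measurable_gen_imp[OF measurable_gen_residual AP_sources_subset] .

lemma indep_residual:
  assumes "j \<in> Ad" "j' \<in> Ad" "j \<noteq> j'" "k \<in> U"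
  shows "indep_pair M borel (residual j k i) borel (residual j' k i)"
  using assms by (intro indep_pair_gen[OF measurable_gen_residual measurable_gen_residual]
    AP_sources_subset AP_sources_disjoint)

text \<open>The difference is the residual variance of a regression, a quotient of positive
  quantities.\<close>

lemma alpha_square_le:
  assumes j: "j \<in> Ad" and k: "k \<in> U"
  shows "0 \<le> \<beta> j k - (\<alpha> j k)\<^sup>2"
proof -
  have "0 < pilot_var j (pilot_group U l (l k) - {k})"
    by (rule pilot_var_pos[OF j]) (auto simp: pilot_group_def)
  then show ?thesis
    unfolding estimation_error_variance[OF j k, symmetric]
    using \<beta>_pos[OF j k] pilot_var_pos[OF j pilot_group_subset, of "l k"] by simp
qed

text \<open>The error is independent of \<open>Z j\<close>, hence of the precoder; symmetry gives
  mean 0, and the unit mean power of the precoder leaves the variance of the error.\<close>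

lemma residual_moments:
  assumes j: "j \<in> Ad" and k: "k \<in> U"
  shows "(\<integral>\<omega>. residual j k i \<omega> \<partial>M) = 0"
    and "integrable M (\<lambda>\<omega>. (cmod (residual j k i \<omega>))\<^sup>2)"
    and "(\<integral>\<omega>. (cmod (residual j k i \<omega>))\<^sup>2 \<partial>M) = \<beta> j k - (\<alpha> j k)\<^sup>2"
proof -
  have ind: "indep_pair M borel (estimation_error j k) borel (p j i)"
    unfolding zf_precoder_eq[OF j, abs_def]
    using indep_pair_compose[OF indep_estimation_error[OF j k] measurable_ident borel_measurable_scaled_zf_direction]
    by simp
  have [measurable]: "residual j k i \<in> borel_measurable M" by (rule measurable_residual[OF j k])
  show "(\<integral>\<omega>. residual j k i \<omega> \<partial>M) = 0"
    unfolding residual_def by (rule integral_cinner_indep[OF ind distr_estimation_error[OF j k]])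
  have nn: "(\<integral>\<^sup>+\<omega>. ennreal ((cmod (residual j k i \<omega>))\<^sup>2) \<partial>M) = ennreal (\<beta> j k - (\<alpha> j k)\<^sup>2)"
    unfolding residual_def
    using nn_integral_cinner_indep[OF ind distr_estimation_error[OF j k] alpha_square_le[OF j k]]
    by (simp add: nn_integral_zf_precoder[OF j])
  then show "integrable M (\<lambda>\<omega>. (cmod (residual j k i \<omega>))\<^sup>2)"
    by (intro integrableI_bounded) auto
  show "(\<integral>\<omega>. (cmod (residual j k i \<omega>))\<^sup>2 \<partial>M) = \<beta> j k - (\<alpha> j k)\<^sup>2"
    using alpha_square_le[OF j k] by (subst integral_eq_nn_integral) (auto simp: nn)
qed

text \<open>The equation is almost sure, as zero forcing needs full rank. The constant is nonzero
  for every user on pilot \<open>i\<close>, not only for the served one; this is the origin of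
  coherent interference.\<close>

lemma AE_effective_channel:
  assumes j: "j \<in> Ad" and k: "k \<in> U"
  shows "AE \<omega> in M. cinner (f j k \<omega>) (p j i \<omega>) =
    of_real (if l k = i then sqrt (real CARD('n) - real CARD('t)) * \<alpha> j k else 0) + residual j k i \<omega>"
  using AE_column_zf_direction[OF j, of "l k" i]
proof eventually_elim
  fix \<omega> assume zf: "cinner (column (l k) (Z j \<omega>)) (zf_direction (Z j \<omega>) i) = (if l k = i then 1 else 0)"
  define s where "s = pilot_var j (pilot_group U l (l k))"
  \<comment> \<open>The regression coefficient. It satisfies
    \<open>\<alpha> j k = a * sqrt s\<close>, and the scaling of the precoder supplies the factor
    \<open>sqrt s\<close>.\<close>
  define a where "a = sqrt (real CARD('t) * Ep k) * \<beta> j k / s"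
  have s: "0 < s" unfolding s_def by (rule pilot_var_pos[OF j pilot_group_subset])
  \<comment> \<open>Recovering \<alpha> from its square uses that it is nonnegative.\<close>
  have "\<alpha> j k = sqrt ((\<alpha> j k)\<^sup>2)"
    using \<beta>_pos[OF j k] Ep_pos[OF k] s
    by (simp add: alpha_coeff_def c_coeff_def flip: pilot_var_def s_def)
  also have "\<dots> = sqrt (real CARD('t) * Ep k) * \<beta> j k / sqrt s"
    unfolding alpha_square[OF j k] s_def[symmetric] using \<beta>_pos[OF j k]
    by (simp add: real_sqrt_mult real_sqrt_divide)
  also have "\<dots> = a * sqrt s" using s by (simp add: a_def field_simps)
  finally have \<alpha>: "\<alpha> j k = a * sqrt s" .
  have "f j k \<omega> = estimation_error j k \<omega> + a *\<^sub>R column (l k) (Z j \<omega>)"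
    by (simp add: estimation_error_def a_def s_def)
  then have "cinner (f j k \<omega>) (p j i \<omega>) = residual j k i \<omega> + a *\<^sub>R cinner (column (l k) (Z j \<omega>)) (p j i \<omega>)"
    by (simp add: residual_def cinner_add_left cinner_scaleR_left)
  also have "a *\<^sub>R cinner (column (l k) (Z j \<omega>)) (p j i \<omega>) = of_real (if l k = i then sqrt (real CARD('n) - real CARD('t)) * \<alpha> j k else 0)"
    unfolding zf_precoder_eq[OF j] cinner_scaleR_right zf
    by (auto simp: \<alpha> s_def real_sqrt_mult scaleR_conv_of_real mult_ac)
  finally show "cinner (f j k \<omega>) (p j i \<omega>) =
      of_real (if l k = i then sqrt (real CARD('n) - real CARD('t)) * \<alpha> j k else 0) + residual j k i \<omega>" by simp
qed

lemma measurable_effective_channel: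
  assumes j: "j \<in> Ad" and k: "k \<in> U"
  shows "(\<lambda>\<omega>. cinner (f j k \<omega>) (p j i \<omega>)) \<in> borel_measurable M"
proof -
  have [measurable]: "Z j \<in> borel_measurable M" "f j k \<in> borel_measurable M"
    using measurable_Z[OF j] CN_f[OF j k] by (auto simp: has_CN_def)
  show ?thesis unfolding zf_precoder_eq[OF j] by measurable
qed

lemma
  assumes j: "j \<in> Ad" and k: "k \<in> U"
  shows integrable_effective_channel: "integrable M (\<lambda>\<omega>. cinner (f j k \<omega>) (p j i \<omega>))"
    and integral_effective_channel:
      "(\<integral>\<omega>. cinner (f j k \<omega>) (p j i \<omega>) \<partial>M) = of_real (if l k = i then sqrt (real CARD('n) - real CARD('t)) * \<alpha> j k else 0)"
proof -
  define m where "m = complex_of_real (if l k = i then sqrt (real CARD('n) - real CARD('t)) * \<alpha> j k else 0)"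
  have int: "integrable M (residual j k i)"
    by (rule integrable_of_square_integrable[OF measurable_residual[OF j k] residual_moments(2)[OF j k]])
  have AE: "AE \<omega> in M. cinner (f j k \<omega>) (p j i \<omega>) = m + residual j k i \<omega>"
    unfolding m_def by (rule AE_effective_channel[OF j k])
  have meas: "(\<lambda>\<omega>. m + residual j k i \<omega>) \<in> borel_measurable M"
    using measurable_residual[OF j k] by measurable
  show "integrable M (\<lambda>\<omega>. cinner (f j k \<omega>) (p j i \<omega>))"
    using integrable_cong_AE[OF measurable_effective_channel[OF j k] meas AE] int by simp
  show "(\<integral>\<omega>. cinner (f j k \<omega>) (p j i \<omega>) \<partial>M) = of_real (if l k = i then sqrt (real CARD('n) - real CARD('t)) * \<alpha> j k else 0)"
    using integral_cong_AE[OF measurable_effective_channel[OF j k] meas AE] int residual_moments(1)[OF j k]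
    by (simp add: prob_space flip: m_def)
qed

text \<open>The constants of the APs add up coherently, the residuals only in power. The free
  \<open>c\<close> serves twice: the mean gives the variance of the desired signal, 0 the
  interference power.\<close>

lemma second_moment_received:
  fixes \<kappa> :: "'a \<Rightarrow> real" and c :: complex
  assumes fin: "finite Ad" and k: "k \<in> U"
  shows "(\<integral>\<omega>. (cmod ((\<Sum>j\<in>Ad. of_real (\<kappa> j) * cinner (f j k \<omega>) (p j i \<omega>)) - c))\<^sup>2 \<partial>M) =
    (cmod (of_real (if l k = i then sqrt (real CARD('n) - real CARD('t)) * (\<Sum>j\<in>Ad. \<kappa> j * \<alpha> j k) else 0) - c))\<^sup>2 +
    (\<Sum>j\<in>Ad. (\<kappa> j)\<^sup>2 * (\<beta> j k - (\<alpha> j k)\<^sup>2))"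
proof -
  define m where "m = complex_of_real (if l k = i then sqrt (real CARD('n) - real CARD('t)) * (\<Sum>j\<in>Ad. \<kappa> j * \<alpha> j k) else 0) - c"
  have [measurable]: "residual j k i \<in> borel_measurable M" "(\<lambda>\<omega>. cinner (f j k \<omega>) (p j i \<omega>)) \<in> borel_measurable M"
    if "j \<in> Ad" for j
    using measurable_residual measurable_effective_channel that k by auto
  have "AE \<omega> in M. \<forall>j\<in>Ad. cinner (f j k \<omega>) (p j i \<omega>) =
      of_real (if l k = i then sqrt (real CARD('n) - real CARD('t)) * \<alpha> j k else 0) + residual j k i \<omega>"
    using AE_effective_channel k fin by (intro AE_finite_allI) auto
  then have "AE \<omega> in M. (cmod ((\<Sum>j\<in>Ad. of_real (\<kappa> j) * cinner (f j k \<omega>) (p j i \<omega>)) - c))\<^sup>2 =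
      (cmod (m + (\<Sum>j\<in>Ad. of_real (\<kappa> j) * residual j k i \<omega>)))\<^sup>2"
  proof eventually_elim
    fix \<omega> assume *: "\<forall>j\<in>Ad. cinner (f j k \<omega>) (p j i \<omega>) =
      of_real (if l k = i then sqrt (real CARD('n) - real CARD('t)) * \<alpha> j k else 0) + residual j k i \<omega>"
    have "(\<Sum>j\<in>Ad. of_real (\<kappa> j) * cinner (f j k \<omega>) (p j i \<omega>)) =
        (\<Sum>j\<in>Ad. of_real (\<kappa> j) * of_real (if l k = i then sqrt (real CARD('n) - real CARD('t)) * \<alpha> j k else 0)) +
        (\<Sum>j\<in>Ad. of_real (\<kappa> j) * residual j k i \<omega>)"
      using * by (simp add: distrib_left flip: sum.distrib)
    also have "(\<Sum>j\<in>Ad. of_real (\<kappa> j) * complex_of_real (if l k = i then sqrt (real CARD('n) - real CARD('t)) * \<alpha> j k else 0)) = m + c"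
      by (auto simp: m_def sum_distrib_left mult_ac)
    finally show "(cmod ((\<Sum>j\<in>Ad. of_real (\<kappa> j) * cinner (f j k \<omega>) (p j i \<omega>)) - c))\<^sup>2 =
      (cmod (m + (\<Sum>j\<in>Ad. of_real (\<kappa> j) * residual j k i \<omega>)))\<^sup>2" by (simp add: algebra_simps)
  qed
  then have "(\<integral>\<omega>. (cmod ((\<Sum>j\<in>Ad. of_real (\<kappa> j) * cinner (f j k \<omega>) (p j i \<omega>)) - c))\<^sup>2 \<partial>M) =
      (\<integral>\<omega>. (cmod (m + (\<Sum>j\<in>Ad. of_real (\<kappa> j) * residual j k i \<omega>)))\<^sup>2 \<partial>M)"
    by (intro integral_cong_AE) measurable
  also have "\<dots> = (cmod m)\<^sup>2 + (\<Sum>j\<in>Ad. (\<kappa> j)\<^sup>2 * (\<integral>\<omega>. (cmod (residual j k i \<omega>))\<^sup>2 \<partial>M))"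
    using k by (intro second_moment_indep_sum[OF fin] measurable_residual indep_residual residual_moments(1,2))
  finally show ?thesis using residual_moments(3) k by (simp add: m_def)
qed

end

theorem lemma4:
  fixes M :: "'w measure"
    and Ad :: "'a set" and Uu Ud :: "'u set"
    and f :: "'a \<Rightarrow> 'u \<Rightarrow> 'w \<Rightarrow> complex^'n::finite"
    and w :: "'a \<Rightarrow> 't::finite \<Rightarrow> 'w \<Rightarrow> complex^'n"
    and g :: "'u \<Rightarrow> 'u \<Rightarrow> 'w \<Rightarrow> complex"
    and \<beta> \<kappa> :: "'a \<Rightarrow> 'u \<Rightarrow> real" and \<epsilon> :: "'u \<Rightarrow> 'u \<Rightarrow> real"
    and l :: "'u \<Rightarrow> 't" and Ep Eu :: "'u \<Rightarrow> real" and Ed N0 :: real and n :: 'u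
  assumes "prob_space M"
    and "finite Ad" and "finite Uu" and "finite Ud" and "Uu \<inter> Ud = {}"
    and "\<And>j k. j \<in> Ad \<Longrightarrow> k \<in> Uu \<union> Ud \<Longrightarrow> \<beta> j k > 0"
    and "\<And>m k. m \<in> Ud \<Longrightarrow> k \<in> Uu \<Longrightarrow> \<epsilon> m k \<ge> 0"
    and "\<And>k. k \<in> Uu \<union> Ud \<Longrightarrow> Ep k > 0"
    and "\<And>k. k \<in> Uu \<Longrightarrow> Eu k \<ge> 0"
    and "\<And>j q. j \<in> Ad \<Longrightarrow> q \<in> Ud \<Longrightarrow> \<kappa> j q \<ge> 0"
    and "Ed > 0" and "N0 > 0"
    and "\<And>j k. j \<in> Ad \<Longrightarrow> k \<in> Uu \<union> Ud \<Longrightarrow> has_CN M (f j k) (\<beta> j k)"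
    and "\<And>j i. j \<in> Ad \<Longrightarrow> has_CN M (w j i) N0"
    and "\<And>m k. m \<in> Ud \<Longrightarrow> k \<in> Uu \<Longrightarrow> has_CN M (g m k) (\<epsilon> m k)"
    and "prob_space.indep_sets M (source_events M f w g) (sources Ad Uu Ud)"
    and "CARD('n) \<ge> CARD('t) + 1"
    and "n \<in> Ud"
  shows
    "let \<alpha> = alpha_coeff (Uu \<union> Ud) l Ep \<beta> N0;
         p = (\<lambda>j q. zf_precoder M (despread_matrix (Uu \<union> Ud) l Ep f w j) (l q));
         EST = (\<Sum>q\<in>Ud. \<Sum>j\<in>Ad. Ed * (\<kappa> j q)\<^sup>2 * (\<beta> j n - (\<alpha> j n)\<^sup>2));
         MUI = (real CARD('n) - real CARD('t)) * Ed *
               (\<Sum>q\<in>(pilot_group (Uu \<union> Ud) l (l n) \<inter> Ud) - {n}. (\<Sum>j\<in>Ad. \<kappa> j q * \<alpha> j n)\<^sup>2);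
         IUE = (\<Sum>k\<in>Uu. Eu k * \<epsilon> n k)
     in downlink_sinr M Ad Uu Ud Ed Eu N0 \<kappa> f g p n =
          (real CARD('n) - real CARD('t)) * Ed * (\<Sum>j\<in>Ad. \<alpha> j n * \<kappa> j n)\<^sup>2 /
          (EST + MUI + IUE + N0)"
proof -
  interpret pilot_model M Ad Uu Ud f w g \<beta> l Ep N0
    using assms by (intro pilot_model.intro pilot_model_axioms.intro) auto
  have n: "n \<in> U" using assms(18) by simp
  note finite_sets = assms(2-4)
  define P where "P = (\<lambda>j q. zf_precoder M (Z j) (l q))"
  \<comment> \<open>\<open>V q\<close> is the power of the residuals under the weights of user
    \<open>q\<close>, and \<open>m q\<close> the coherent mean, which vanishes unless
    \<open>q\<close> shares the pilot of \<open>n\<close>.\<close>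
  define V where "V = (\<lambda>q. \<Sum>j\<in>Ad. (\<kappa> j q)\<^sup>2 * (\<beta> j n - (\<alpha> j n)\<^sup>2))"
  define m where "m = (\<lambda>q. if l n = l q then sqrt (real CARD('n) - real CARD('t)) * (\<Sum>j\<in>Ad. \<kappa> j q * \<alpha> j n) else 0)"
  have mean: "precode Ad \<kappa> n (\<lambda>j. \<integral>\<omega>. eff_channel f P n n \<omega> j \<partial>M) = of_real (m n)"
    by (simp add: precode_def eff_channel_def P_def integral_effective_channel[OF _ n] m_def sum_distrib_left mult_ac)
  have moment: "(\<integral>\<omega>. (cmod (precode Ad \<kappa> q (eff_channel f P n q \<omega>) - c))\<^sup>2 \<partial>M) =
      (cmod (of_real (m q) - c))\<^sup>2 + V q" for q c
    unfolding precode_def eff_channel_def P_def m_def V_def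
    by (rule second_moment_received[OF assms(2) n])
  have "(\<integral>\<omega>. precode Ad \<kappa> n (eff_channel f P n n \<omega>) \<partial>M) =
      precode Ad \<kappa> n (\<lambda>j. \<integral>\<omega>. eff_channel f P n n \<omega> j \<partial>M)"
    unfolding precode_def eff_channel_def P_def
    by (subst Bochner_Integration.integral_sum) (auto intro: integrable_effective_channel[OF _ n])
  also note mean
  finally have "(\<integral>\<omega>. precode Ad \<kappa> n (eff_channel f P n n \<omega>) \<partial>M) = of_real (m n)" .
  \<comment> \<open>Here \<open>c\<close> is the mean, so the coherent part cancels and only
    \<open>V n\<close> is left.\<close>
  then have var: "cvariance M (\<lambda>\<omega>. precode Ad \<kappa> n (eff_channel f P n n \<omega>)) = V n"
    unfolding cvariance_def moment by simp
  have interference: "(\<integral>\<omega>. (cmod (precode Ad \<kappa> q (eff_channel f P n q \<omega>)))\<^sup>2 \<partial>M) = (m q)\<^sup>2 + V q" for q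
    using moment[of q 0] by simp
  have uplink: "(\<Sum>k\<in>Uu. Eu k * (\<integral>\<omega>. (cmod (g n k \<omega>))\<^sup>2 \<partial>M)) = (\<Sum>k\<in>Uu. Eu k * \<epsilon> n k)"
    using assms(7,15,18) by (intro sum.cong refl) (simp add: integral_norm_square_CN_complex)
  have m2: "(m q)\<^sup>2 = (if l n = l q then (real CARD('n) - real CARD('t)) * (\<Sum>j\<in>Ad. \<kappa> j q * \<alpha> j n)\<^sup>2 else 0)" for q
    using card_diff_pos by (simp add: m_def power_mult_distrib)
  \<comment> \<open>Among the interferers only those on the pilot of \<open>n\<close> contribute a
    coherent mean.\<close>
  have "(\<Sum>q\<in>Ud - {n}. (m q)\<^sup>2) = (\<Sum>q\<in>{q \<in> Ud - {n}. l n = l q}. (real CARD('n) - real CARD('t)) * (\<Sum>j\<in>Ad. \<kappa> j q * \<alpha> j n)\<^sup>2)"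
    unfolding m2 using finite_sets by (subst sum.inter_filter[symmetric]) auto
  also have "{q \<in> Ud - {n}. l n = l q} = (pilot_group U l (l n) \<inter> Ud) - {n}"
    by (auto simp: pilot_group_def)
  finally have MUI: "(\<Sum>q\<in>Ud - {n}. (m q)\<^sup>2) =
      (real CARD('n) - real CARD('t)) * (\<Sum>q\<in>(pilot_group U l (l n) \<inter> Ud) - {n}. (\<Sum>j\<in>Ad. \<kappa> j q * \<alpha> j n)\<^sup>2)"
    by (simp add: sum_distrib_left)
  \<comment> \<open>The sum over all users joins the variance \<open>V n\<close> of the desired
    signal with the incoherent parts \<open>V q\<close> of the interferers.\<close>
  have EST: "(\<Sum>q\<in>Ud. \<Sum>j\<in>Ad. Ed * (\<kappa> j q)\<^sup>2 * (\<beta> j n - (\<alpha> j n)\<^sup>2)) = Ed * (V n + (\<Sum>q\<in>Ud - {n}. V q))"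
    unfolding sum.remove[OF assms(4,18), of V, symmetric] by (simp add: V_def sum_distrib_left mult.assoc)
  have signal: "Ed * (cmod (of_real (m n)))\<^sup>2 = (real CARD('n) - real CARD('t)) * Ed * (\<Sum>j\<in>Ad. \<alpha> j n * \<kappa> j n)\<^sup>2"
    by (simp add: m2 mult_ac)
  have "downlink_sinr M Ad Uu Ud Ed Eu N0 \<kappa> f g P n =
      (real CARD('n) - real CARD('t)) * Ed * (\<Sum>j\<in>Ad. \<alpha> j n * \<kappa> j n)\<^sup>2 /
      (Ed * V n + Ed * (\<Sum>q\<in>Ud - {n}. (m q)\<^sup>2 + V q) + (\<Sum>k\<in>Uu. Eu k * \<epsilon> n k) + N0)"
    unfolding downlink_sinr_def mean var interference uplink signal ..
  also have "Ed * V n + Ed * (\<Sum>q\<in>Ud - {n}. (m q)\<^sup>2 + V q) =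
      Ed * (V n + (\<Sum>q\<in>Ud - {n}. V q)) + (real CARD('n) - real CARD('t)) * Ed * (\<Sum>q\<in>(pilot_group U l (l n) \<inter> Ud) - {n}. (\<Sum>j\<in>Ad. \<kappa> j q * \<alpha> j n)\<^sup>2)"
    unfolding sum.distrib MUI by (simp add: algebra_simps)
  finally show ?thesis
    unfolding Let_def EST P_def .
qed

end
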